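(* Let $(S_n)$ be the multidimensional elephant random walk with stops on $\mathbb{Z}^d$ with parameters $p,q\in[0,1]$, $r\in(0,1)$, $p+(2d-1)q+r=1$, in the superdiffusive regime $p>p_{d,r}$, where $p_{d,r}=\left(\frac{2d+1}{4d}\right)(1-r)$. Let $$\vartheta^2=\frac{(2d-1)(1-r)}{d\big(4dp-(2d+1)(1-r)\big)}.$$ Then there is a non-degenerate random vector $L$ of $\mathbb{R}^d$ such that $$\lim_{n\to\infty}\frac{S_n}{n^{p-q}}=L\quad\text{almost surely.}$$ Moreover, one has the mean square convergence $$\lim_{n\to\infty}\mathbb{E}\left[\left\|\frac{S_n}{n^{p-q}}-L\right\|^2\right]=0.$$ In addition, $\mathbb{E}[L]=0$ and the covariance matrix of $L$ is given by $$\mathbb{E}[LL^T]=\frac{\vartheta^2}{(1-r)\,\Gamma(2(p-q))}\,I_d.$$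
   Context: Multidimensional elephant random walk with stops (MERWS). Let $d\ge1$ be an integer and $p,q\in[0,1]$, $r\in(0,1)$ with $p+(2d-1)q+r=1$. Let $I_d$ be the $d\times d$ identity matrix and $J_d$ the $d\times d$ cyclic permutation matrix with $(J_d)_{i,i+1}=1$ for $1\le i\le d-1$, $(J_d)_{d,1}=1$, and all other entries $0$. Let $(e_1,\dots,e_d)$ be the standard basis of $\mathbb{R}^d$. Set $S_0=0$, let $X_1$ be uniformly distributed on the $2d$ vectors $\pm e_1,\dots,\pm e_d$, and $S_1=X_1$. For all $n\ge1$, $X_{n+1}=A_{n+1}X_{U_{n+1}}$ and $S_{n+1}=S_n+X_{n+1}$, where $U_{n+1}$ is uniformly distributed on $\{1,\dots,n\}$ and $A_{n+1}$ is a random matrix equal to $I_d$ with probability $p$, to $-I_d$ with probability $q$, to each of $J_d^i$ and $-J_d^i$ ($1\le i\le d-1$) with probability $q$, and to the zero matrix with probability $r$; $A_{n+1}$ and $U_{n+1}$ are independent of each other and of $\mathcal{F}_n=\sigma(X_1,\dots,X_n)$. $\|\cdot\|$ is the Euclidean norm and $\Gamma$ is the Euler Gamma function. *)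

theory Defs
  imports "HOL-Probability.Probability"
begin

(* The index type 'd of real^'d carries no order, so idx enumerates it as idx 1, ..., idx d with
   d = CARD('d): the standard basis is e_k = axis (idx k) 1, and entry (k, l) of a matrix A is
   A $ idx k $ idx l. *)
definition cyclic_mat :: "(nat \<Rightarrow> 'd::finite) \<Rightarrow> real^'d^'d" where
  "cyclic_mat idx = (\<chi> a b.
     if (\<exists>i. 1 \<le> i \<and> i \<le> CARD('d) - 1 \<and> a = idx i \<and> b = idx (i + 1)) \<or>
        (a = idx (CARD('d)) \<and> b = idx 1)
     then 1 else 0)"

(* The library power operation on vectors and matrices is componentwise; this one iterates the
   matrix product. *)
definition mat_power :: "real^'d^'d \<Rightarrow> nat \<Rightarrow> real^('d::finite)^'d" where
  "mat_power A k = ((\<lambda>B. A ** B) ^^ k) (mat 1)"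

definition outer :: "real^'d \<Rightarrow> real^'d \<Rightarrow> real^('d::finite)^'d" where
  "outer u v = (\<chi> i j. u $ i * v $ j)"

definition sigma_rv :: "'a measure \<Rightarrow> 'b measure \<Rightarrow> ('a \<Rightarrow> 'b) \<Rightarrow> 'a set set" where
  "sigma_rv M N Y = {Y -` B \<inter> space M | B. B \<in> sets N}"

(* The natural filtration F_n = sigma(X_1, ..., X_n). *)
definition history :: "'a measure \<Rightarrow> (nat \<Rightarrow> 'a \<Rightarrow> real^'d) \<Rightarrow> nat \<Rightarrow> 'a set set" where
  "history M X n = sigma_sets (space M) (\<Union>k\<in>{1..n}. sigma_rv M borel (X k))"

(* The values X 0, A 0, A 1, U 0, U 1 play no role.  The prescribed point masses in each of the
   three laws add up to 1. *)
locale merws = prob_space M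
  for M :: "'a measure" +
  fixes p q r :: real
    and idx :: "nat \<Rightarrow> 'd::finite"
    and X :: "nat \<Rightarrow> 'a \<Rightarrow> real^'d"
    and A :: "nat \<Rightarrow> 'a \<Rightarrow> real^'d^'d"
    and U :: "nat \<Rightarrow> 'a \<Rightarrow> nat"
  assumes p_range: "p \<in> {0..1}"
    and q_range: "q \<in> {0..1}"
    and r_range: "r \<in> {0<..<1}"
    and pqr: "p + (2 * real CARD('d) - 1) * q + r = 1"
    and idx: "bij_betw idx {1..CARD('d)} UNIV"
    and X_rv: "\<And>n. n \<ge> 1 \<Longrightarrow> X n \<in> borel_measurable M"
    and A_rv: "\<And>n. n \<ge> 1 \<Longrightarrow> A (n + 1) \<in> borel_measurable M"
    and U_rv: "\<And>n. n \<ge> 1 \<Longrightarrow> U (n + 1) \<in> measurable M (count_space UNIV)"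
    and X1_law: "\<And>k s. k \<in> {1..CARD('d)} \<Longrightarrow> s \<in> {1, -1} \<Longrightarrow>
      prob {\<omega> \<in> space M. X 1 \<omega> = s *\<^sub>R axis (idx k) 1} = 1 / (2 * real CARD('d))"
    and X_step: "\<And>n \<omega>. n \<ge> 1 \<Longrightarrow> \<omega> \<in> space M \<Longrightarrow>
      X (n + 1) \<omega> = A (n + 1) \<omega> *v X (U (n + 1) \<omega>) \<omega>"
    and U_law: "\<And>n k. n \<ge> 1 \<Longrightarrow> k \<in> {1..n} \<Longrightarrow>
      prob {\<omega> \<in> space M. U (n + 1) \<omega> = k} = 1 / real n"
    and A_law_id: "\<And>n. n \<ge> 1 \<Longrightarrow> prob {\<omega> \<in> space M. A (n + 1) \<omega> = mat 1} = p"
    and A_law_neg_id: "\<And>n. n \<ge> 1 \<Longrightarrow> prob {\<omega> \<in> space M. A (n + 1) \<omega> = - mat 1} = q"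
    and A_law_cyclic: "\<And>n i. n \<ge> 1 \<Longrightarrow> 1 \<le> i \<Longrightarrow> i \<le> CARD('d) - 1 \<Longrightarrow>
      prob {\<omega> \<in> space M. A (n + 1) \<omega> = mat_power (cyclic_mat idx) i} = q"
    and A_law_neg_cyclic: "\<And>n i. n \<ge> 1 \<Longrightarrow> 1 \<le> i \<Longrightarrow> i \<le> CARD('d) - 1 \<Longrightarrow>
      prob {\<omega> \<in> space M. A (n + 1) \<omega> = - mat_power (cyclic_mat idx) i} = q"
    and A_law_zero: "\<And>n. n \<ge> 1 \<Longrightarrow> prob {\<omega> \<in> space M. A (n + 1) \<omega> = 0} = r"
    and indep: "\<And>n. n \<ge> 1 \<Longrightarrow>
      indep_sets (\<lambda>i. [sigma_rv M borel (A (n + 1)),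
                       sigma_rv M (count_space UNIV) (U (n + 1)),
                       history M X n] ! i) {..<3}"

definition walk :: "(nat \<Rightarrow> 'a \<Rightarrow> real^'d) \<Rightarrow> nat \<Rightarrow> 'a \<Rightarrow> real^'d" where
  "walk X n \<omega> = (\<Sum>k=1..n. X k \<omega>)"

(* The law of Y is not carried by a proper affine subspace; in particular Y is not almost surely
   constant. *)
definition nondegenerate :: "'a measure \<Rightarrow> ('a \<Rightarrow> real^'d::finite) \<Rightarrow> bool" where
  "nondegenerate M Y \<longleftrightarrow> (\<forall>u c. u \<noteq> 0 \<longrightarrow> \<not> (AE \<omega> in M. u \<bullet> Y \<omega> = c))"

definition p_crit :: "nat \<Rightarrow> real \<Rightarrow> real" where
  "p_crit d r = ((2 * real d + 1) / (4 * real d)) * (1 - r)"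

definition vartheta_sq :: "nat \<Rightarrow> real \<Rightarrow> real \<Rightarrow> real" where
  "vartheta_sq d p r =
     ((2 * real d - 1) * (1 - r)) / (real d * (4 * real d * p - (2 * real d + 1) * (1 - r)))"

end

theory Submission
  imports Defs
begin

text \<open>
  The idea is that the walk, seen coordinate by coordinate, is a martingale after a deterministic
  rescaling, and that in the superdiffusive regime this martingale is bounded in $L^2$.

  Write $a = p - q$ and $b = 1 - r$.  The step matrix $A$ is a signed power of the cyclic permutation
  matrix or zero, and the contributions of $J^i$ and $-J^i$ to its mean cancel except for $\pm I$;
  hence $E[A] = a I$, while $A A^T$ is $I$ or $0$ and so has mean $b I$.  Since the remembered time is
  uniform and independent of the past, the next step has conditional mean $(a/n) S_n$
  (\<open>conditional_mean\<close>).  So each coordinate of $S_n$ divided by $\prod_{k<n} (1 + a/k)$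
  (\<open>growth\<close>) is a martingale (\<open>normalised_walk_martingale\<close>), and by the Gamma function
  limit that product is asymptotic to $n^a / \Gamma(1 + a)$ (\<open>growth_asymptotics\<close>).

  The second moments obey exact recursions.  The identity for $A A^T$ preserves isotropy, so
  all step covariances, and then all walk covariances, are multiples of the identity
  (\<open>isotropic_step\<close>, \<open>step_covariance\<close>, \<open>walk_covariance\<close>).  Solving the recursion gives a
  combination of $\prod_{k<n} (1 + 2a/k)$, of order $n^{2a}$, and $\prod_{k<n} (1 + b/k)$, of order
  $n^b$.  The hypothesis on $p$ says precisely that $2a > b$ (\<open>superdiffusive\<close>); the first
  term then dominates, which bounds the martingale in $L^2$ and yields the limiting covariance
  (\<open>walk_var_asymptotics\<close>).

  An $L^2$-bounded martingale converges almost surely and in $L^2$.  The almost sure statement comes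
  from Kolmogorov's maximal inequality, the mean square statement from Fatou's lemma
  (\<open>L2_martingale.convergence\<close>).  Mean square convergence carries first and second moments to the
  limit $L$; as its covariance is a positive multiple of the identity, no nontrivial linear functional
  of $L$ is constant.
\<close>

section \<open>Square-integrable functions\<close>

definition sq_integrable :: "'a measure \<Rightarrow> ('a \<Rightarrow> real) \<Rightarrow> bool" where
  "sq_integrable M f \<longleftrightarrow> f \<in> borel_measurable M \<and> integrable M (\<lambda>x. (f x)\<^sup>2)"

lemma sq_integrable_measurable: "sq_integrable M f \<Longrightarrow> f \<in> borel_measurable M"
  and sq_integrable_square: "sq_integrable M f \<Longrightarrow> integrable M (\<lambda>x. (f x)\<^sup>2)"
  by (auto simp: sq_integrable_def)

lemma sq_integrable_mult:
  assumes "sq_integrable M f" "sq_integrable M g"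
  shows "integrable M (\<lambda>x. f x * g x)"
proof (rule Bochner_Integration.integrable_bound[where f = "\<lambda>x. (f x)\<^sup>2 + (g x)\<^sup>2"])
  have "\<bar>u * v\<bar> \<le> u\<^sup>2 + v\<^sup>2" for u v :: real
  proof -
    have "0 \<le> (\<bar>u\<bar> - \<bar>v\<bar>)\<^sup>2" "0 \<le> \<bar>u\<bar> * \<bar>v\<bar>" by auto
    moreover have "(\<bar>u\<bar> - \<bar>v\<bar>)\<^sup>2 = u\<^sup>2 + v\<^sup>2 - 2 * (\<bar>u\<bar> * \<bar>v\<bar>)"
      by (simp add: power2_diff)
    ultimately show ?thesis unfolding abs_mult by linarith
  qed
  then show "AE x in M. norm (f x * g x) \<le> norm ((f x)\<^sup>2 + (g x)\<^sup>2)"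
    by (intro AE_I2) simp
qed (use assms in \<open>auto simp: sq_integrable_def\<close>)

lemma sq_integrable_cmult: "sq_integrable M f \<Longrightarrow> sq_integrable M (\<lambda>x. c * f x)"
  by (auto simp: sq_integrable_def power_mult_distrib)

lemma sq_integrable_add:
  assumes "sq_integrable M f" "sq_integrable M g"
  shows "sq_integrable M (\<lambda>x. f x + g x)"
  using assms sq_integrable_mult[OF assms] unfolding sq_integrable_def power2_sum
  by (auto simp: mult.assoc)

lemma sq_integrable_diff:
  assumes "sq_integrable M f" "sq_integrable M g"
  shows "sq_integrable M (\<lambda>x. f x - g x)"
  using sq_integrable_add[OF assms(1) sq_integrable_cmult[OF assms(2), of "-1"]] by simp

text \<open>The quadratic polynomial $t \mapsto \int (f - t g)^2$ is nonnegative; evaluating it at its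
  minimiser gives the inequality.\<close>

lemma Cauchy_Schwarz_integral:
  assumes f: "sq_integrable M f" and g: "sq_integrable M g"
  shows "(\<integral>x. f x * g x \<partial>M)\<^sup>2 \<le> (\<integral>x. (f x)\<^sup>2 \<partial>M) * (\<integral>x. (g x)\<^sup>2 \<partial>M)"
proof -
  define u v w where "u = (\<integral>x. (f x)\<^sup>2 \<partial>M)" and "v = (\<integral>x. (g x)\<^sup>2 \<partial>M)"
    and "w = (\<integral>x. f x * g x \<partial>M)"
  have *: "0 \<le> u - 2 * t * w + t\<^sup>2 * v" for t
  proof -
    have "0 \<le> (\<integral>x. (f x - t * g x)\<^sup>2 \<partial>M)" by simp
    also have "\<dots> = (\<integral>x. (f x)\<^sup>2 - (2 * t) * (f x * g x) + t\<^sup>2 * (g x)\<^sup>2 \<partial>M)"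
      by (intro Bochner_Integration.integral_cong) (auto simp: power2_eq_square algebra_simps)
    also have "\<dots> = u - 2 * t * w + t\<^sup>2 * v"
      using sq_integrable_mult[OF f g] sq_integrable_square[OF f] sq_integrable_square[OF g]
      by (simp add: u_def v_def w_def)
    finally show ?thesis .
  qed
  have "v \<ge> 0" by (simp add: v_def)
  show ?thesis
  proof (cases "v = 0")
    case True
    have "w = 0"
    proof (rule ccontr)
      assume "w \<noteq> 0"
      \<comment> \<open>With $v = 0$ the polynomial is linear in $t$; this $t$ makes it equal to $-1$.\<close>
      with *[of "(u + 1) / (2 * w)"] True show False by simp
    qed
    then show ?thesis using True by (simp add: u_def v_def w_def)
  next
    case False
    with *[of "w / v"] \<open>v \<ge> 0\<close> have "w\<^sup>2 \<le> u * v"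
      by (simp add: field_simps power2_eq_square)
    then show ?thesis by (simp add: u_def v_def w_def)
  qed
qed

definition L2_tendsto :: "'a measure \<Rightarrow> (nat \<Rightarrow> 'a \<Rightarrow> real) \<Rightarrow> ('a \<Rightarrow> real) \<Rightarrow> bool" where
  "L2_tendsto M f g \<longleftrightarrow> (\<forall>n. sq_integrable M (f n)) \<and> sq_integrable M g \<and>
     (\<lambda>n. \<integral>x. (f n x - g x)\<^sup>2 \<partial>M) \<longlonglongrightarrow> 0"

text \<open>Writing $f_n f'_n - g g'$ as $(f_n - g)(f'_n - g') + (f_n - g) g' + g (f'_n - g')$, each term has
  integral tending to zero by Cauchy-Schwarz.  This is how means and covariances pass to the limit.\<close>

lemma L2_tendsto_product_integral:
  assumes "L2_tendsto M f g" "L2_tendsto M f' g'"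
  shows "(\<lambda>n. \<integral>x. f n x * f' n x \<partial>M) \<longlonglongrightarrow> (\<integral>x. g x * g' x \<partial>M)"
proof -
  have f: "\<And>n. sq_integrable M (f n)" "\<And>n. sq_integrable M (f' n)"
    and g: "sq_integrable M g" "sq_integrable M g'"
    and lim: "(\<lambda>n. \<integral>x. (f n x - g x)\<^sup>2 \<partial>M) \<longlonglongrightarrow> 0" "(\<lambda>n. \<integral>x. (f' n x - g' x)\<^sup>2 \<partial>M) \<longlonglongrightarrow> 0"
    using assms by (auto simp: L2_tendsto_def)
  have zero: "(\<lambda>n. \<integral>x. h n x * k n x \<partial>M) \<longlonglongrightarrow> 0"
    if sq: "\<And>n. sq_integrable M (h n)" "\<And>n. sq_integrable M (k n)"
      and z: "(\<lambda>n. (\<integral>x. (h n x)\<^sup>2 \<partial>M) * (\<integral>x. (k n x)\<^sup>2 \<partial>M)) \<longlonglongrightarrow> 0" for h k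
  proof -
    have "(\<lambda>n. (\<integral>x. h n x * k n x \<partial>M)\<^sup>2) \<longlonglongrightarrow> 0"
      by (rule real_tendsto_sandwich[OF _ _ tendsto_const z])
        (auto intro!: always_eventually Cauchy_Schwarz_integral sq)
    then show ?thesis by (simp add: power_tendsto_0_iff)
  qed
  have d: "sq_integrable M (\<lambda>x. f n x - g x)" "sq_integrable M (\<lambda>x. f' n x - g' x)" for n
    using f g sq_integrable_diff by blast+
  have l1: "(\<lambda>n. \<integral>x. (f n x - g x) * (f' n x - g' x) \<partial>M) \<longlonglongrightarrow> 0"
    by (rule zero[OF d]) (use tendsto_mult[OF lim] in simp)
  have l2: "(\<lambda>n. \<integral>x. (f n x - g x) * g' x \<partial>M) \<longlonglongrightarrow> 0"
    by (rule zero[OF d(1) g(2)]) (rule tendsto_mult_left_zero[OF lim(1)])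
  have l3: "(\<lambda>n. \<integral>x. g x * (f' n x - g' x) \<partial>M) \<longlonglongrightarrow> 0"
    by (rule zero[OF g(1) d(2)]) (rule tendsto_mult_right_zero[OF lim(2)])
  have split: "(\<integral>x. f n x * f' n x \<partial>M) = (\<integral>x. g x * g' x \<partial>M) +
     ((\<integral>x. (f n x - g x) * (f' n x - g' x) \<partial>M) + (\<integral>x. (f n x - g x) * g' x \<partial>M)
      + (\<integral>x. g x * (f' n x - g' x) \<partial>M))" for n
  proof -
    note i = sq_integrable_mult[OF d(1) d(2), of n n] sq_integrable_mult[OF d(1) g(2), of n]
      sq_integrable_mult[OF g(1) d(2), of n] sq_integrable_mult[OF g]
    have "(\<integral>x. f n x * f' n x \<partial>M) = (\<integral>x. g x * g' x +
     ((f n x - g x) * (f' n x - g' x) + (f n x - g x) * g' x + g x * (f' n x - g' x)) \<partial>M)"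
      by (intro Bochner_Integration.integral_cong) (auto simp: algebra_simps)
    then show ?thesis using i by simp
  qed
  show ?thesis
    unfolding split using tendsto_add[OF tendsto_const tendsto_add[OF tendsto_add[OF l1 l2] l3]]
    by simp
qed

text \<open>Changes the normalisation of a convergent sequence: here the martingale normalisation is replaced
  by the power of $n$.\<close>

lemma L2_tendsto_scale:
  assumes "L2_tendsto M f g" "c \<longlonglongrightarrow> l"
  shows "L2_tendsto M (\<lambda>n x. c n * f n x) (\<lambda>x. l * g x)"
proof -
  have f: "\<And>n. sq_integrable M (f n)"
    and g: "sq_integrable M g"
    and lim: "(\<lambda>n. \<integral>x. (f n x - g x)\<^sup>2 \<partial>M) \<longlonglongrightarrow> 0"
    using assms by (auto simp: L2_tendsto_def)
  note d = sq_integrable_diff[OF f g]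
  have eq: "(\<integral>x. (c n * f n x - l * g x)\<^sup>2 \<partial>M) = (c n)\<^sup>2 * (\<integral>x. (f n x - g x)\<^sup>2 \<partial>M)
     + 2 * c n * (c n - l) * (\<integral>x. (f n x - g x) * g x \<partial>M) + (c n - l)\<^sup>2 * (\<integral>x. (g x)\<^sup>2 \<partial>M)" for n
  proof -
    have "(\<integral>x. (c n * f n x - l * g x)\<^sup>2 \<partial>M) = (\<integral>x. (c n)\<^sup>2 * (f n x - g x)\<^sup>2
     + 2 * c n * (c n - l) * ((f n x - g x) * g x) + (c n - l)\<^sup>2 * (g x)\<^sup>2 \<partial>M)"
      by (intro Bochner_Integration.integral_cong) (auto simp: algebra_simps power2_eq_square)
    then show ?thesis
      using sq_integrable_mult[OF d g, of n] sq_integrable_square[OF d, of n] sq_integrable_square[OF g]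
      by simp
  qed
  have "L2_tendsto M (\<lambda>n x. f n x - g x) (\<lambda>x. 0)" "L2_tendsto M (\<lambda>n. g) g"
    using d lim g by (auto simp: L2_tendsto_def sq_integrable_def)
  from L2_tendsto_product_integral[OF this]
  have "(\<lambda>n. \<integral>x. (f n x - g x) * g x \<partial>M) \<longlonglongrightarrow> 0" by simp
  then have "(\<lambda>n. \<integral>x. (c n * f n x - l * g x)\<^sup>2 \<partial>M) \<longlonglongrightarrow> l\<^sup>2 * 0 + 2 * l * (l - l) * 0 + (l - l)\<^sup>2 * (\<integral>x. (g x)\<^sup>2 \<partial>M)"
    unfolding eq
    by (intro tendsto_add tendsto_mult tendsto_power tendsto_diff tendsto_const lim assms(2))
  then show ?thesis
    using f g by (auto simp: L2_tendsto_def intro: sq_integrable_cmult)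
qed

lemma L2_tendsto_imp_Suc:
  assumes "L2_tendsto M (\<lambda>n. f (Suc n)) g" "sq_integrable M (f 0)"
  shows "L2_tendsto M f g"
proof -
  have "sq_integrable M (f n)" for n
    using assms by (cases n) (auto simp: L2_tendsto_def)
  moreover have "(\<lambda>n. \<integral>x. (f n x - g x)\<^sup>2 \<partial>M) \<longlonglongrightarrow> 0"
    by (rule LIMSEQ_imp_Suc) (use assms(1) in \<open>simp add: L2_tendsto_def\<close>)
  ultimately show ?thesis using assms(1) by (simp add: L2_tendsto_def)
qed

lemma (in prob_space) sq_integrable_bounded:
  assumes "f \<in> borel_measurable M" "AE x in M. \<bar>f x\<bar> \<le> B"
  shows "sq_integrable M f"
  unfolding sq_integrable_def
proof
  show "integrable M (\<lambda>x. (f x)\<^sup>2)"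
  proof (rule integrable_const_bound[of _ "B\<^sup>2"])
    show "AE x in M. norm ((f x)\<^sup>2) \<le> B\<^sup>2"
      using assms(2) by eventually_elim (use power_mono[of "\<bar>_\<bar>" B 2] in simp)
  qed (use assms(1) in measurable)
qed fact

lemma (in prob_space) sq_integrable_const: "sq_integrable M (\<lambda>_. c)"
  by (simp add: sq_integrable_def)

lemma (in prob_space) sq_integrable_integrable: "sq_integrable M f \<Longrightarrow> integrable M f"
  using sq_integrable_mult[OF _ sq_integrable_const[of 1]] by simp

section \<open>Martingales bounded in mean square\<close>

text \<open>The martingale property in the form needed for Hilbert space arguments: increments are orthogonal
  to every square-integrable function of the past.\<close>

locale L2_martingale = prob_space M for M :: "'a measure" +
  fixes F :: "nat \<Rightarrow> 'a measure" and Y :: "nat \<Rightarrow> 'a \<Rightarrow> real"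
  assumes sub: "subalgebra M (F n)"
    and filtration: "sets (F n) \<subseteq> sets (F (Suc n))"
    and adapted: "Y n \<in> borel_measurable (F n)"
    and sq_int: "sq_integrable M (Y n)"
    and increment_orthogonal: "Z \<in> borel_measurable (F n) \<Longrightarrow> sq_integrable M Z \<Longrightarrow>
      (\<integral>\<omega>. Z \<omega> * (Y (Suc n) \<omega> - Y n \<omega>) \<partial>M) = 0"
begin

lemma adapted_le: "m \<le> n \<Longrightarrow> Y m \<in> borel_measurable (F n)"
proof (rule measurable_from_subalg[OF _ adapted])
  assume "m \<le> n"
  then have "sets (F m) \<subseteq> sets (F n)" by (rule lift_Suc_mono_le[of "\<lambda>n. sets (F n)", OF filtration])
  then show "subalgebra (F n) (F m)" using sub[of m] sub[of n] by (simp add: subalgebra_def)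
qed

lemma shift: "L2_martingale M (\<lambda>n. F (m + n)) (\<lambda>n. Y (m + n))"
  by unfold_locales (use sub filtration adapted sq_int increment_orthogonal in auto)

lemma increment_orthogonal_le:
  assumes Z: "Z \<in> borel_measurable (F m)" "sq_integrable M Z"
  shows "(\<integral>\<omega>. Z \<omega> * (Y (m + k) \<omega> - Y m \<omega>) \<partial>M) = 0"
proof (induction k)
  case (Suc k)
  have "sets (F m) \<subseteq> sets (F (m + k))"
    by (rule lift_Suc_mono_le[of "\<lambda>n. sets (F n)", OF filtration]) simp
  then have Zk: "Z \<in> borel_measurable (F (m + k))"
    using sub[of m] sub[of "m + k"] by (intro measurable_from_subalg[OF _ Z(1)]) (simp add: subalgebra_def)
  have "(\<integral>\<omega>. Z \<omega> * (Y (m + Suc k) \<omega> - Y m \<omega>) \<partial>M) =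
      (\<integral>\<omega>. Z \<omega> * (Y (Suc (m + k)) \<omega> - Y (m + k) \<omega>) + Z \<omega> * (Y (m + k) \<omega> - Y m \<omega>) \<partial>M)"
    by (intro Bochner_Integration.integral_cong) (auto simp: algebra_simps)
  also have "\<dots> = 0 + 0"
    using Suc increment_orthogonal[OF Zk Z(2)]
      sq_integrable_mult[OF Z(2) sq_integrable_diff[OF sq_int sq_int]] by simp
  finally show ?case by simp
qed simp

text \<open>Pythagoras: $Y_m$ is orthogonal to $Y_{m+k} - Y_m$.\<close>

lemma increment_variance:
  "(\<integral>\<omega>. (Y (m + k) \<omega> - Y m \<omega>)\<^sup>2 \<partial>M) = (\<integral>\<omega>. (Y (m + k) \<omega>)\<^sup>2 \<partial>M) - (\<integral>\<omega>. (Y m \<omega>)\<^sup>2 \<partial>M)"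
proof -
  note i = sq_integrable_square[OF sq_int] sq_integrable_mult[OF sq_int sq_integrable_diff[OF sq_int sq_int]]
  have "(\<integral>\<omega>. (Y (m + k) \<omega> - Y m \<omega>)\<^sup>2 \<partial>M) =
      (\<integral>\<omega>. (Y (m + k) \<omega>)\<^sup>2 - (Y m \<omega>)\<^sup>2 - 2 * (Y m \<omega> * (Y (m + k) \<omega> - Y m \<omega>)) \<partial>M)"
    by (intro Bochner_Integration.integral_cong) (auto simp: algebra_simps power2_eq_square)
  then show ?thesis
    using i increment_orthogonal_le[OF adapted sq_int, of m k] by simp
qed

lemma incseq_variance: "incseq (\<lambda>n. \<integral>\<omega>. (Y n \<omega>)\<^sup>2 \<partial>M)"
proof (rule incseq_SucI)
  fix n
  have "0 \<le> (\<integral>\<omega>. (Y (n + 1) \<omega> - Y n \<omega>)\<^sup>2 \<partial>M)" by simp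
  then show "(\<integral>\<omega>. (Y n \<omega>)\<^sup>2 \<partial>M) \<le> (\<integral>\<omega>. (Y (Suc n) \<omega>)\<^sup>2 \<partial>M)"
    unfolding increment_variance by simp
qed

text \<open>Stop the process at the first time it leaves the $\epsilon$-tube around $Y_0$.  The stopped process
  $T$ is again a sum of orthogonal increments, with second moment at most that of $Y_N - Y_0$, and it
  stays outside the tube once $Y$ has left it, so Markov's inequality for $T_N^2$ suffices.\<close>

lemma Kolmogorov_maximal_inequality:
  assumes "\<epsilon> > 0"
  shows "prob {\<omega> \<in> space M. \<exists>k\<le>N. \<epsilon> \<le> \<bar>Y k \<omega> - Y 0 \<omega>\<bar>} \<le>
    ((\<integral>\<omega>. (Y N \<omega>)\<^sup>2 \<partial>M) - (\<integral>\<omega>. (Y 0 \<omega>)\<^sup>2 \<partial>M)) / \<epsilon>\<^sup>2"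
proof -
  \<comment> \<open>$G_k$ is the event that the process has not left the tube up to time $k$.\<close>
  define G where "G k = {\<omega> \<in> space M. \<forall>j\<le>k. \<bar>Y j \<omega> - Y 0 \<omega>\<bar> < \<epsilon>}" for k
  have spF: "space (F k) = space M" for k using sub by (simp add: subalgebra_def)
  have YM[measurable]: "Y k \<in> borel_measurable M" for k using sq_int sq_integrable_measurable by blast
  have GF: "G k \<in> sets (F k)" for k
  proof -
    have this_sets: "{\<omega> \<in> space (F k). \<bar>Y j \<omega> - Y 0 \<omega>\<bar> < \<epsilon>} \<in> sets (F k)" if "j \<le> k" for j
    proof -
      have [measurable]: "Y j \<in> borel_measurable (F k)" "Y 0 \<in> borel_measurable (F k)"
        using that by (auto intro: adapted_le)
      show ?thesis by measurable
    qed
    have "G k = {\<omega> \<in> space (F k). \<forall>j\<in>{..k}. \<bar>Y j \<omega> - Y 0 \<omega>\<bar> < \<epsilon>}"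
      by (auto simp: G_def spF)
    also have "\<dots> \<in> sets (F k)" 
      using this_sets by (intro sets.sets_Collect_finite_All) auto
    finally show ?thesis .
  qed
  have GM[measurable]: "G k \<in> sets M" for k using GF sub by (auto simp: subalgebra_def)
  define T where "T n \<omega> = (\<Sum>k<n. indicator (G k) \<omega> * (Y (Suc k) \<omega> - Y k \<omega>))" for n \<omega>
  have TSuc: "T (Suc n) \<omega> = T n \<omega> + indicator (G n) \<omega> * (Y (Suc n) \<omega> - Y n \<omega>)" for n \<omega>
    by (simp add: T_def)
  have TF: "T n \<in> borel_measurable (F n)" for n
  proof -
    have "(\<lambda>\<omega>. indicator (G k) \<omega> * (Y (Suc k) \<omega> - Y k \<omega>)) \<in> borel_measurable (F n)" if "k < n" for k
    proof -
      have "sets (F k) \<subseteq> sets (F n)"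
        by (rule lift_Suc_mono_le[of "\<lambda>n. sets (F n)", OF filtration]) (use that in simp)
      then have [measurable]: "G k \<in> sets (F n)" using GF by blast
      have [measurable]: "Y k \<in> borel_measurable (F n)" "Y (Suc k) \<in> borel_measurable (F n)"
        using that by (auto intro!: adapted_le)
      show ?thesis by measurable
    qed
    then show ?thesis unfolding T_def by (intro borel_measurable_sum) auto
  qed
  have sq_ind: "sq_integrable M (\<lambda>\<omega>. indicator (G n) \<omega> * (Y (Suc n) \<omega> - Y n \<omega>))" for n
  proof -
    have "integrable M (\<lambda>x. (Y (Suc n) x - Y n x)\<^sup>2 * indicator (G n) x)"
      by (intro integrable_real_mult_indicator GM sq_integrable_square[OF sq_integrable_diff[OF sq_int sq_int]])
    moreover have "(indicator (G n) x * (Y (Suc n) x - Y n x))\<^sup>2 = (Y (Suc n) x - Y n x)\<^sup>2 * indicator (G n) x" for x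
      by (simp add: indicator_def)
    ultimately show ?thesis by (simp add: sq_integrable_def)
  qed
  have Tsq: "sq_integrable M (T n)" for n
    by (induction n) (auto simp: T_def sq_integrable_def[of M "\<lambda>_. 0"] intro: sq_integrable_add sq_ind)
  have var: "(\<integral>\<omega>. (T n \<omega>)\<^sup>2 \<partial>M) \<le> (\<integral>\<omega>. (Y n \<omega>)\<^sup>2 \<partial>M) - (\<integral>\<omega>. (Y 0 \<omega>)\<^sup>2 \<partial>M)" for n
  proof (induction n)
    case (Suc n)
    let ?D = "\<lambda>\<omega>. Y (Suc n) \<omega> - Y n \<omega>"
    have TG: "(\<lambda>\<omega>. T n \<omega> * indicator (G n) \<omega>) \<in> borel_measurable (F n)"
      using TF[of n] GF[of n] by measurable
    have "integrable M (\<lambda>x. (T n x)\<^sup>2 * indicator (G n) x)"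
      by (intro integrable_real_mult_indicator GM sq_integrable_square[OF Tsq])
    moreover have "(T n x * indicator (G n) x)\<^sup>2 = (T n x)\<^sup>2 * indicator (G n) x" for x
      by (simp add: indicator_def)
    ultimately have TGsq: "sq_integrable M (\<lambda>\<omega>. T n \<omega> * indicator (G n) \<omega>)"
      using sq_integrable_measurable[OF Tsq] by (simp add: sq_integrable_def)
    have "(\<integral>\<omega>. (T (Suc n) \<omega>)\<^sup>2 \<partial>M) = (\<integral>\<omega>. (T n \<omega>)\<^sup>2 + 2 * ((T n \<omega> * indicator (G n) \<omega>) * ?D \<omega>)
        + (indicator (G n) \<omega> * ?D \<omega>)\<^sup>2 \<partial>M)"
      unfolding TSuc by (intro Bochner_Integration.integral_cong) (auto simp: algebra_simps power2_eq_square)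
    also have "\<dots> = (\<integral>\<omega>. (T n \<omega>)\<^sup>2 \<partial>M) + (\<integral>\<omega>. (indicator (G n) \<omega> * ?D \<omega>)\<^sup>2 \<partial>M)"
      using increment_orthogonal[OF TG TGsq] sq_integrable_square[OF Tsq, of n] sq_integrable_square[OF sq_ind, of n]
        sq_integrable_mult[OF TGsq sq_integrable_diff[OF sq_int sq_int], of "Suc n" n]
      by simp
    also have "(\<integral>\<omega>. (indicator (G n) \<omega> * ?D \<omega>)\<^sup>2 \<partial>M) \<le> (\<integral>\<omega>. (?D \<omega>)\<^sup>2 \<partial>M)"
      by (intro integral_mono sq_integrable_square sq_ind sq_integrable_diff sq_int)
        (auto simp: indicator_def)
    also have "(\<integral>\<omega>. (?D \<omega>)\<^sup>2 \<partial>M) = (\<integral>\<omega>. (Y (Suc n) \<omega>)\<^sup>2 \<partial>M) - (\<integral>\<omega>. (Y n \<omega>)\<^sup>2 \<partial>M)"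
      using increment_variance[of n 1] by simp
    finally show ?case using Suc by simp
  qed (simp add: T_def)
  have stopped: "(\<omega> \<in> G n \<longrightarrow> T n \<omega> = Y n \<omega> - Y 0 \<omega>) \<and> (\<omega> \<notin> G n \<longrightarrow> \<epsilon> \<le> \<bar>T n \<omega>\<bar>)"
    if "\<omega> \<in> space M" for \<omega> n
  proof (induction n)
    case 0
    show ?case using that assms by (simp add: T_def G_def)
  next
    case (Suc n)
    show ?case
    proof (cases "\<omega> \<in> G n")
      case True
      then have "T (Suc n) \<omega> = Y (Suc n) \<omega> - Y 0 \<omega>" using Suc by (simp add: TSuc)
      then show ?thesis using True by (auto simp: G_def le_Suc_eq not_less)
    next
      case False
      then have "\<omega> \<notin> G (Suc n)" by (auto simp: G_def le_Suc_eq)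
      then show ?thesis using False Suc by (simp add: TSuc)
    qed
  qed
  have [measurable]: "T N \<in> borel_measurable M" using Tsq sq_integrable_measurable by blast
  have "prob {\<omega> \<in> space M. \<exists>k\<le>N. \<epsilon> \<le> \<bar>Y k \<omega> - Y 0 \<omega>\<bar>} \<le> prob {\<omega> \<in> space M. \<epsilon>\<^sup>2 \<le> (T N \<omega>)\<^sup>2}"
  proof (rule finite_measure_mono)
    show "{\<omega> \<in> space M. \<exists>k\<le>N. \<epsilon> \<le> \<bar>Y k \<omega> - Y 0 \<omega>\<bar>} \<subseteq> {\<omega> \<in> space M. \<epsilon>\<^sup>2 \<le> (T N \<omega>)\<^sup>2}"
    proof clarify
      fix \<omega> k assume w: "\<omega> \<in> space M" "k \<le> N" "\<epsilon> \<le> \<bar>Y k \<omega> - Y 0 \<omega>\<bar>"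
      then have "\<omega> \<notin> G N" by (force simp: G_def)
      then have "\<epsilon> \<le> \<bar>T N \<omega>\<bar>" using stopped w(1) by blast
      then show "\<epsilon>\<^sup>2 \<le> (T N \<omega>)\<^sup>2" using assms abs_le_square_iff[of \<epsilon> "T N \<omega>"] by simp
    qed
  qed simp
  also have "\<dots> \<le> (\<integral>\<omega>. (T N \<omega>)\<^sup>2 \<partial>M) / \<epsilon>\<^sup>2"
    using integral_Markov_inequality_measure[where A = "{}" and c = "\<epsilon>\<^sup>2" and u = "\<lambda>\<omega>. (T N \<omega>)\<^sup>2" and M = M] assms
      sq_integrable_square[OF Tsq, of N] by simp
  also have "\<dots> \<le> ((\<integral>\<omega>. (Y N \<omega>)\<^sup>2 \<partial>M) - (\<integral>\<omega>. (Y 0 \<omega>)\<^sup>2 \<partial>M)) / \<epsilon>\<^sup>2"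
    by (intro divide_right_mono var) simp
  finally show ?thesis .
qed

text \<open>The maximal inequality, applied from time $m$ on, bounds the probability that the process ever
  moves by $\epsilon$ after time $m$ by a multiple of $V - E[Y_m^2]$, which tends to zero; so almost
  every path is Cauchy.  Fatou's lemma applied to $(Y_{m+k} - Y_m)^2$ as $k \to \infty$ gives the
  mean square convergence.\<close>

theorem convergence:
  assumes bdd: "(\<lambda>n. \<integral>\<omega>. (Y n \<omega>)\<^sup>2 \<partial>M) \<longlonglongrightarrow> V"
  obtains Z where "AE \<omega> in M. (\<lambda>n. Y n \<omega>) \<longlonglongrightarrow> Z \<omega>" "L2_tendsto M Y Z"
proof -
  let ?v = "\<lambda>n. \<integral>\<omega>. (Y n \<omega>)\<^sup>2 \<partial>M"
  have YM[measurable]: "Y k \<in> borel_measurable M" for k using sq_int sq_integrable_measurable by blast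
  have vV: "?v n \<le> V" for n using incseq_le[OF incseq_variance bdd] .
  \<comment> \<open>$E_{\epsilon, m}$ is the event that the process moves by $\epsilon$ at some time after $m$.\<close>
  define E where "E \<epsilon> m = {\<omega> \<in> space M. \<exists>k. \<epsilon> \<le> \<bar>Y (m + k) \<omega> - Y m \<omega>\<bar>}" for \<epsilon> :: real and m
  have EM[measurable]: "E \<epsilon> m \<in> sets M" for \<epsilon> m unfolding E_def by measurable
  have tail: "prob (E \<epsilon> m) \<le> (V - ?v m) / \<epsilon>\<^sup>2" if "\<epsilon> > 0" for \<epsilon> m
  proof -
    interpret S: L2_martingale M "\<lambda>n. F (m + n)" "\<lambda>n. Y (m + n)" by (rule shift)
    let ?B = "\<lambda>N. {\<omega> \<in> space M. \<exists>k\<le>N. \<epsilon> \<le> \<bar>Y (m + k) \<omega> - Y m \<omega>\<bar>}"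
    have "(\<lambda>N. prob (?B N)) \<longlonglongrightarrow> prob (\<Union>N. ?B N)"
    proof (rule finite_Lim_measure_incseq)
      show "incseq ?B" by (auto simp: incseq_def) (meson order_trans)
    qed auto
    moreover have "(\<Union>N. ?B N) = E \<epsilon> m" by (auto simp: E_def)
    moreover have "prob (?B N) \<le> (V - ?v m) / \<epsilon>\<^sup>2" for N
    proof -
      have "prob (?B N) \<le> (?v (m + N) - ?v m) / \<epsilon>\<^sup>2"
        using S.Kolmogorov_maximal_inequality[OF that, of N] by simp
      also have "\<dots> \<le> (V - ?v m) / \<epsilon>\<^sup>2" by (intro divide_right_mono) (use vV in auto)
      finally show ?thesis .
    qed
    ultimately show ?thesis by (metis (no_types, lifting) LIMSEQ_le_const2)
  qed
  have small: "AE \<omega> in M. \<exists>m. \<forall>k. \<bar>Y (m + k) \<omega> - Y m \<omega>\<bar> < \<epsilon>" if "\<epsilon> > 0" for \<epsilon>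
  proof -
    have "(\<lambda>m. (V - ?v m) / \<epsilon>\<^sup>2) \<longlonglongrightarrow> (V - V) / \<epsilon>\<^sup>2" by (intro tendsto_intros bdd) (use that in simp)
    moreover have "prob (\<Inter>m. E \<epsilon> m) \<le> (V - ?v m) / \<epsilon>\<^sup>2" for m
      by (rule order_trans[OF finite_measure_mono tail]) (use that in auto)
    ultimately have "prob (\<Inter>m. E \<epsilon> m) \<le> (V - V) / \<epsilon>\<^sup>2"
      by (intro LIMSEQ_le_const) auto
    then have "prob (\<Inter>m. E \<epsilon> m) = 0" by (simp add: antisym)
    then have "(\<Inter>m. E \<epsilon> m) \<in> null_sets M" by (auto simp: measure_eq_0_null_sets emeasure_eq_measure intro!: null_setsI)
    then show ?thesis
      by (rule AE_I') (auto simp: E_def not_less)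
  qed
  have "AE \<omega> in M. \<forall>i::nat. \<exists>m. \<forall>k. \<bar>Y (m + k) \<omega> - Y m \<omega>\<bar> < 1 / Suc i"
    unfolding AE_all_countable by (intro allI small) simp
  then have conv: "AE \<omega> in M. convergent (\<lambda>n. Y n \<omega>)"
  proof eventually_elim
    case (elim \<omega>)
    have "Cauchy (\<lambda>n. Y n \<omega>)"
      unfolding Cauchy_altdef2
    proof (intro allI impI)
      fix e :: real assume "e > 0"
      then obtain i where i: "1 / Suc i < e" using nat_approx_posE by blast
      obtain m where m: "\<forall>k. \<bar>Y (m + k) \<omega> - Y m \<omega>\<bar> < 1 / Suc i" using elim by blast
      have "dist (Y n \<omega>) (Y m \<omega>) < e" if "n \<ge> m" for n
        using m[rule_format, of "n - m"] that i by (simp add: dist_real_def)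
      then show "\<exists>N. \<forall>n\<ge>N. dist (Y n \<omega>) (Y N \<omega>) < e" by blast
    qed
    then show ?case by (rule real_Cauchy_convergent)
  qed
  define Z where "Z \<omega> = lim (\<lambda>n. Y n \<omega>)" for \<omega>
  have ZM[measurable]: "Z \<in> borel_measurable M" unfolding Z_def by measurable
  have lim: "AE \<omega> in M. (\<lambda>n. Y n \<omega>) \<longlonglongrightarrow> Z \<omega>"
    using conv by eventually_elim (simp add: Z_def convergent_LIMSEQ_iff)
  have fatou: "(\<integral>\<^sup>+\<omega>. ennreal ((Y m \<omega> - Z \<omega>)\<^sup>2) \<partial>M) \<le> ennreal (V - ?v m)" for m
  proof -
    have "(\<integral>\<^sup>+\<omega>. ennreal ((Y m \<omega> - Z \<omega>)\<^sup>2) \<partial>M) =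
        (\<integral>\<^sup>+\<omega>. liminf (\<lambda>k. ennreal ((Y (m + k) \<omega> - Y m \<omega>)\<^sup>2)) \<partial>M)"
    proof (rule nn_integral_cong_AE)
      show "AE \<omega> in M. ennreal ((Y m \<omega> - Z \<omega>)\<^sup>2) = liminf (\<lambda>k. ennreal ((Y (m + k) \<omega> - Y m \<omega>)\<^sup>2))"
        using lim
      proof eventually_elim
        case (elim \<omega>)
        have "(\<lambda>k. Y (m + k) \<omega>) \<longlonglongrightarrow> Z \<omega>" using LIMSEQ_ignore_initial_segment[OF elim, of m] by (simp add: add.commute)
        then have "(\<lambda>k. ennreal ((Y (m + k) \<omega> - Y m \<omega>)\<^sup>2)) \<longlonglongrightarrow> ennreal ((Z \<omega> - Y m \<omega>)\<^sup>2)"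
          by (intro tendsto_intros tendsto_ennrealI)
        then have "liminf (\<lambda>k. ennreal ((Y (m + k) \<omega> - Y m \<omega>)\<^sup>2)) = ennreal ((Z \<omega> - Y m \<omega>)\<^sup>2)"
          by (rule lim_imp_Liminf[OF sequentially_bot])
        also have "(Z \<omega> - Y m \<omega>)\<^sup>2 = (Y m \<omega> - Z \<omega>)\<^sup>2" by (rule power2_commute)
        finally show ?case by (rule sym)
      qed
    qed
    also have "\<dots> \<le> liminf (\<lambda>k. \<integral>\<^sup>+\<omega>. ennreal ((Y (m + k) \<omega> - Y m \<omega>)\<^sup>2) \<partial>M)"
      by (intro nn_integral_liminf) measurable
    also have "(\<lambda>k. \<integral>\<^sup>+\<omega>. ennreal ((Y (m + k) \<omega> - Y m \<omega>)\<^sup>2) \<partial>M) = (\<lambda>k. ennreal (?v (m + k) - ?v m))"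
      unfolding increment_variance[symmetric]
      by (intro ext nn_integral_eq_integral sq_integrable_square sq_integrable_diff sq_int) auto
    also have "liminf (\<lambda>k. ennreal (?v (m + k) - ?v m)) = ennreal (V - ?v m)"
    proof (rule lim_imp_Liminf)
      have "(\<lambda>k. ?v (m + k)) \<longlonglongrightarrow> V" using LIMSEQ_ignore_initial_segment[OF bdd, of m] by (simp add: add.commute)
      then show "(\<lambda>k. ennreal (?v (m + k) - ?v m)) \<longlonglongrightarrow> ennreal (V - ?v m)"
        by (intro tendsto_intros tendsto_ennrealI)
    qed simp
    finally show ?thesis .
  qed
  have diff_sq: "sq_integrable M (\<lambda>\<omega>. Y m \<omega> - Z \<omega>)" for m
    unfolding sq_integrable_def
  proof (intro conjI integrableI_bounded)
    show "(\<integral>\<^sup>+ x. ennreal (norm ((Y m x - Z x)\<^sup>2)) \<partial>M) < \<infinity>"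
      using le_less_trans[OF fatou] by simp
  qed measurable
  have "sq_integrable M (\<lambda>\<omega>. Y 0 \<omega> - (Y 0 \<omega> - Z \<omega>))" by (intro sq_integrable_diff sq_int diff_sq)
  then have Zsq: "sq_integrable M Z" by simp
  have upper: "(\<integral>\<omega>. (Y m \<omega> - Z \<omega>)\<^sup>2 \<partial>M) \<le> V - ?v m" for m
    using fatou[of m] vV[of m] by (subst (asm) nn_integral_eq_integral)
      (auto intro!: sq_integrable_square diff_sq)
  have gap: "(\<lambda>m. V - ?v m) \<longlonglongrightarrow> V - V" by (intro tendsto_intros bdd)
  have "(\<lambda>m. \<integral>\<omega>. (Y m \<omega> - Z \<omega>)\<^sup>2 \<partial>M) \<longlonglongrightarrow> 0"
    by (rule tendsto_sandwich[where f = "\<lambda>_. 0" and h = "\<lambda>m. V - ?v m"]) (use upper gap in auto)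
  then have "L2_tendsto M Y Z" using sq_int Zsq by (simp add: L2_tendsto_def)
  with lim show thesis by (rule that)
qed

end

section \<open>Asymptotics of the normalising products\<close>

text \<open>The solution of $u_{n+1} = (1 + z/n) u_n$ with $u_1 = 1$, that is
  $\Gamma(n + z) / (\Gamma(n) \Gamma(1 + z))$ for $n \ge 1$.  Division by zero yields zero, so the
  recursion may start at index $0$.\<close>

primrec growth :: "real \<Rightarrow> nat \<Rightarrow> real" where
  "growth z 0 = 1"
| "growth z (Suc n) = (1 + z / real n) * growth z n"

lemma growth_Suc_pochhammer: "growth z (Suc n) = pochhammer (1 + z) n / fact n"
proof (induction n)
  case (Suc n)
  have "growth z (Suc (Suc n)) = (1 + z / real (Suc n)) * (pochhammer (1 + z) n / fact n)"
    using Suc by simp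
  also have "1 + z / real (Suc n) = (1 + z + real n) / real (Suc n)" by (simp add: field_simps)
  finally show ?case by (simp add: pochhammer_Suc)
qed simp

lemma growth_pos: "z \<ge> 0 \<Longrightarrow> growth z n > 0"
  by (induction n) (auto intro!: mult_pos_pos add_pos_nonneg)

lemma Gamma_recurrence_pos:
  fixes z :: real
  assumes "z > 0"
  shows "Gamma (1 + z) = z * Gamma z"
proof -
  have "z \<notin> \<int>\<^sub>\<le>\<^sub>0" using nonpos_Ints_nonpos[of z] assms by (metis not_le)
  from Gamma_plus1[OF this] show ?thesis by (simp add: add.commute)
qed

text \<open>After the factor $z$ is split off the Pochhammer symbol, the quotient is the reciprocal of $z$ times
  an Euler sequence for the Gamma function.\<close>

lemma growth_asymptotics:
  assumes "z > 0"
  shows "(\<lambda>n. growth z n / real n powr z) \<longlonglongrightarrow> 1 / Gamma (1 + z)"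
proof -
  have nz: "Gamma z \<noteq> 0" using Gamma_real_pos[OF assms] by (metis less_irrefl)
  have "(\<lambda>n. 1 / (z * Gamma_series' z (Suc n))) \<longlonglongrightarrow> 1 / (z * Gamma z)"
    by (intro tendsto_intros LIMSEQ_Suc[OF Gamma_series'_LIMSEQ]) (use assms nz in auto)
  moreover have "z * Gamma z = Gamma (1 + z)"
    using Gamma_recurrence_pos[OF assms] by (rule sym)
  moreover have "1 / (z * Gamma_series' z (Suc n)) = growth z (Suc n) / real (Suc n) powr z" for n
  proof -
    have "pochhammer z (Suc n) = z * pochhammer (1 + z) n" by (simp add: pochhammer_rec add.commute)
    then show ?thesis
      using assms by (simp add: Gamma_series'_def growth_Suc_pochhammer powr_def field_simps del: growth.simps)
  qed
  ultimately have "(\<lambda>n. growth z (Suc n) / real (Suc n) powr z) \<longlonglongrightarrow> 1 / Gamma (1 + z)" by (simp del: growth.simps)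
  then show ?thesis by (rule LIMSEQ_imp_Suc)
qed

lemma growth_smaller_power:
  assumes "0 < z" "z < w"
  shows "(\<lambda>n. growth z n / real n powr w) \<longlonglongrightarrow> 0"
proof -
  have lim: "(\<lambda>n. growth z n / real n powr z * (real n powr (z - w))) \<longlonglongrightarrow> 1 / Gamma (1 + z) * 0"
    by (intro tendsto_mult growth_asymptotics tendsto_neg_powr filterlim_real_sequentially) (use assms in auto)
  have eq: "growth z n / real n powr z * (real n powr (z - w)) = growth z n / real n powr w" if "n > 0" for n
    using that by (simp add: powr_diff)
  show ?thesis
  proof (rule Lim_transform_eventually)
    show "(\<lambda>n. growth z n / real n powr z * (real n powr (z - w))) \<longlonglongrightarrow> 0" using lim by simp
    show "\<forall>\<^sub>F n in sequentially. growth z n / real n powr z * (real n powr (z - w)) = growth z n / real n powr w"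
      using eventually_gt_at_top[of 0] by eventually_elim (rule eq)
  qed
qed

section \<open>The law of the step matrix\<close>

text \<open>The permutation of the coordinates behind $J$: row $a$ of $J$ has its only entry $1$ in column
  \<open>next_idx idx a\<close>.\<close>

definition next_idx :: "(nat \<Rightarrow> 'd::finite) \<Rightarrow> 'd \<Rightarrow> 'd" where
  "next_idx idx a = (let k = inv_into {1..CARD('d)} idx a in if k = CARD('d) then idx 1 else idx (k + 1))"

context
  fixes idx :: "nat \<Rightarrow> 'd::finite"
  assumes idx: "bij_betw idx {1..CARD('d)} UNIV"
begin

lemma idx_eq_iff: "k \<in> {1..CARD('d)} \<Longrightarrow> l \<in> {1..CARD('d)} \<Longrightarrow> idx k = idx l \<longleftrightarrow> k = l"
  using idx inj_on_eq_iff[of idx "{1..CARD('d)}" k l] unfolding bij_betw_def by blast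

lemma idx_cases: obtains k where "k \<in> {1..CARD('d)}" "a = idx k"
proof -
  have "a \<in> idx ` {1..CARD('d)}" using idx by (simp add: bij_betw_def)
  then show ?thesis using that by blast
qed

lemma next_idx_idx:
  "k \<in> {1..CARD('d)} \<Longrightarrow> next_idx idx (idx k) = (if k = CARD('d) then idx 1 else idx (k + 1))"
  using idx by (simp add: next_idx_def bij_betw_def inv_into_f_f)

lemma inj_next_idx: "inj (next_idx idx)"
proof (rule injI)
  fix a b assume eq: "next_idx idx a = next_idx idx b"
  obtain k where k: "k \<in> {1..CARD('d)}" "a = idx k" by (rule idx_cases)
  obtain l where l: "l \<in> {1..CARD('d)}" "b = idx l" by (rule idx_cases)
  have "k = l"
    using eq k l idx_eq_iff[of 1 "l + 1"] idx_eq_iff[of "k + 1" 1] idx_eq_iff[of "k + 1" "l + 1"]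
    by (auto simp: next_idx_idx split: if_splits)
  then show "a = b" using k l by simp
qed

lemma funpow_next_idx: "i < CARD('d) \<Longrightarrow> (next_idx idx ^^ i) (idx 1) = idx (i + 1)"
  by (induction i) (auto simp: next_idx_idx)

lemma cyclic_mat_nth: "cyclic_mat idx $ a $ b = of_bool (b = next_idx idx a)"
proof -
  obtain k where k: "k \<in> {1..CARD('d)}" "a = idx k" by (rule idx_cases)
  have "((\<exists>i. 1 \<le> i \<and> i \<le> CARD('d) - 1 \<and> a = idx i \<and> b = idx (i + 1)) \<or> (a = idx (CARD('d)) \<and> b = idx 1))
     \<longleftrightarrow> b = next_idx idx a" (is "?L \<longleftrightarrow> ?R")
  proof
    assume ?L
    then show ?R
    proof (elim disjE exE conjE)
      fix i assume "1 \<le> i" "i \<le> CARD('d) - 1" "a = idx i" "b = idx (i + 1)"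
      then show ?R using next_idx_idx[of i] by auto
    next
      assume "a = idx (CARD('d))" "b = idx 1"
      then show ?R using next_idx_idx[of "CARD('d)"] by simp
    qed
  next
    assume ?R
    then show ?L using k by (auto simp: next_idx_idx split: if_splits)
  qed
  then show ?thesis by (simp add: cyclic_mat_def)
qed

lemma mat_power_cyclic_nth:
  "mat_power (cyclic_mat idx) i $ a $ b = of_bool (b = (next_idx idx ^^ i) a)"
proof (induction i arbitrary: a)
  case 0
  show ?case by (auto simp: mat_power_def mat_def)
next
  case (Suc i)
  have "mat_power (cyclic_mat idx) (Suc i) $ a $ b =
      (\<Sum>e\<in>UNIV. cyclic_mat idx $ a $ e * mat_power (cyclic_mat idx) i $ e $ b)"
    by (simp add: mat_power_def matrix_matrix_mult_def)
  also have "\<dots> = (\<Sum>e\<in>UNIV. if e = next_idx idx a then of_bool (b = (next_idx idx ^^ i) e) else 0)"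
    by (intro sum.cong) (auto simp: cyclic_mat_nth Suc)
  also have "\<dots> = of_bool (b = (next_idx idx ^^ Suc i) a)"
    by (simp add: funpow_swap1)
  finally show ?case .
qed

text \<open>The law of the step matrix is given by point masses; they can be added up only because these
  $2d$ matrices are distinct.  The row of the first coordinate tells them apart: its only nonzero entry
  is the sign, and its column determines the power.\<close>

lemma signed_cyclic_inj:
  "inj_on (\<lambda>(i, s). s *\<^sub>R mat_power (cyclic_mat idx) i) ({..<CARD('d)} \<times> {1, - 1::real})"
proof (rule inj_onI, clarify)
  fix i j :: nat and s t :: real
  assume i: "i < CARD('d)" "j < CARD('d)" and s: "s \<in> {1, -1}" "t \<in> {1, -1}"
    and eq: "s *\<^sub>R mat_power (cyclic_mat idx) i = t *\<^sub>R mat_power (cyclic_mat idx) j"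
  have "s = t * of_bool (idx (i + 1) = idx (j + 1))"
    using arg_cong[OF eq, of "\<lambda>B. B $ idx 1 $ idx (i + 1)"] i
    by (simp add: mat_power_cyclic_nth funpow_next_idx del: One_nat_def)
  then show "i = j \<and> s = t" using i s idx_eq_iff[of "i + 1" "j + 1"] by (auto simp: of_bool_def split: if_splits)
qed

lemma mat_power_cyclic_nonzero: "mat_power (cyclic_mat idx) i \<noteq> 0"
proof
  assume "mat_power (cyclic_mat idx) i = 0"
  then have "mat_power (cyclic_mat idx) i $ a $ (next_idx idx ^^ i) a = 0" for a by simp
  then show False by (simp add: mat_power_cyclic_nth)
qed

end

context prob_space
begin

text \<open>Point masses that add up to one leave no room for other values, so every expectation reduces to a
  finite sum.\<close>

lemma finitely_supported_law:
  fixes Y :: "'a \<Rightarrow> 'b" and f :: "'b \<Rightarrow> real"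
  assumes fin: "finite V" and ev: "\<And>v. v \<in> V \<Longrightarrow> {\<omega> \<in> space M. Y \<omega> = v} \<in> events"
    and total: "(\<Sum>v\<in>V. prob {\<omega> \<in> space M. Y \<omega> = v}) = 1"
  shows AE_finitely_supported: "AE \<omega> in M. Y \<omega> \<in> V"
    and expectation_finitely_supported: "(\<lambda>\<omega>. f (Y \<omega>)) \<in> borel_measurable M \<Longrightarrow>
      expectation (\<lambda>\<omega>. f (Y \<omega>)) = (\<Sum>v\<in>V. f v * prob {\<omega> \<in> space M. Y \<omega> = v})"
proof -
  have "(\<Sum>v\<in>V. prob {\<omega> \<in> space M. Y \<omega> = v}) = prob (\<Union>v\<in>V. {\<omega> \<in> space M. Y \<omega> = v})"
    by (rule finite_measure_finite_Union[symmetric])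
      (use fin ev in \<open>auto simp: disjoint_family_on_def\<close>)
  then have "prob (\<Union>v\<in>V. {\<omega> \<in> space M. Y \<omega> = v}) = 1" using total by simp
  then have "AE \<omega> in M. \<omega> \<in> (\<Union>v\<in>V. {\<omega> \<in> space M. Y \<omega> = v})" by (rule AE_prob_1)
  then show AE: "AE \<omega> in M. Y \<omega> \<in> V" by eventually_elim auto
  assume f: "(\<lambda>\<omega>. f (Y \<omega>)) \<in> borel_measurable M"
  have "expectation (\<lambda>\<omega>. f (Y \<omega>)) = expectation (\<lambda>\<omega>. \<Sum>v\<in>V. f v * indicator {\<omega> \<in> space M. Y \<omega> = v} \<omega>)"
  proof (rule integral_cong_AE[OF f])
    show "AE \<omega> in M. f (Y \<omega>) = (\<Sum>v\<in>V. f v * indicator {\<omega> \<in> space M. Y \<omega> = v} \<omega>)"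
      using AE AE_space
    proof eventually_elim
      case (elim \<omega>)
      have "(\<Sum>v\<in>V. f v * indicator {\<omega> \<in> space M. Y \<omega> = v} \<omega>) = (\<Sum>v\<in>V. if v = Y \<omega> then f v else 0)"
        using elim by (intro sum.cong) (auto simp: indicator_def)
      then show ?case using elim fin by simp
    qed
    show "(\<lambda>\<omega>. \<Sum>v\<in>V. f v * indicator {\<omega> \<in> space M. Y \<omega> = v} \<omega>) \<in> borel_measurable M"
      using ev by (intro borel_measurable_sum borel_measurable_times borel_measurable_indicator) auto
  qed
  also have "\<dots> = (\<Sum>v\<in>V. f v * prob {\<omega> \<in> space M. Y \<omega> = v})"
    using ev by (subst Bochner_Integration.integral_sum)
      (auto intro!: integrable_mult_right integrable_real_indicator simp: less_top[symmetric] Int_absorb2)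
  finally show "expectation (\<lambda>\<omega>. f (Y \<omega>)) = (\<Sum>v\<in>V. f v * prob {\<omega> \<in> space M. Y \<omega> = v})" .
qed

end

context merws
begin

abbreviation signed_cyclic :: "nat \<Rightarrow> real \<Rightarrow> real^'d^'d" where
  "signed_cyclic i s \<equiv> s *\<^sub>R mat_power (cyclic_mat idx) i"

definition step_values :: "(real^'d^'d) set" where
  "step_values = insert 0 ((\<lambda>(i, s). signed_cyclic i s) ` ({..<CARD('d)} \<times> {1, -1}))"

lemma sum_step_values:
  "(\<Sum>v\<in>step_values. f v) = f 0 + (\<Sum>i<CARD('d). f (signed_cyclic i 1) + f (signed_cyclic i (-1)))"
  for f :: "_ \<Rightarrow> real"
proof -
  have "0 \<notin> (\<lambda>(i, s). signed_cyclic i s) ` ({..<CARD('d)} \<times> {1, -1})"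
    using mat_power_cyclic_nonzero[OF idx] by auto
  then have "(\<Sum>v\<in>step_values. f v) =
      f 0 + sum f ((\<lambda>(i, s). signed_cyclic i s) ` ({..<CARD('d)} \<times> {1, -1}))"
    unfolding step_values_def by (intro sum.insert) auto
  also have "sum f ((\<lambda>(i, s). signed_cyclic i s) ` ({..<CARD('d)} \<times> {1, -1})) =
      (\<Sum>(i, s)\<in>{..<CARD('d)} \<times> {1, -1}. f (signed_cyclic i s))"
    unfolding sum.reindex[OF signed_cyclic_inj[OF idx]] by (intro sum.cong) auto
  also have "(\<Sum>(i, s)\<in>{..<CARD('d)} \<times> {1, -1}. f (signed_cyclic i s)) =
      (\<Sum>i<CARD('d). f (signed_cyclic i 1) + f (signed_cyclic i (-1)))"
    by (subst sum.cartesian_product[symmetric]) simp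
  finally show ?thesis .
qed

lemma A_prob:
  assumes "n \<ge> 1"
  shows "prob {\<omega> \<in> space M. A (n + 1) \<omega> = 0} = r"
    and "i < CARD('d) \<Longrightarrow> prob {\<omega> \<in> space M. A (n + 1) \<omega> = signed_cyclic i 1} = (if i = 0 then p else q)"
    and "i < CARD('d) \<Longrightarrow> prob {\<omega> \<in> space M. A (n + 1) \<omega> = signed_cyclic i (-1)} = q"
proof -
  have z: "mat_power (cyclic_mat idx) 0 = mat 1" by (simp add: mat_power_def)
  show "prob {\<omega> \<in> space M. A (n + 1) \<omega> = 0} = r" using A_law_zero[OF assms] .
  show "i < CARD('d) \<Longrightarrow> prob {\<omega> \<in> space M. A (n + 1) \<omega> = signed_cyclic i 1} = (if i = 0 then p else q)"
    using A_law_cyclic[OF assms, of i] A_law_id[OF assms] by (auto simp: z)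
  show "i < CARD('d) \<Longrightarrow> prob {\<omega> \<in> space M. A (n + 1) \<omega> = signed_cyclic i (-1)} = q"
    using A_law_neg_cyclic[OF assms, of i] A_law_neg_id[OF assms] by (cases "i = 0") (auto simp: z)
qed

text \<open>The mass of the nonzero values: the identity has weight $p$, the other $2d - 1$ signed powers
  weight $q$.\<close>

lemma sum_weights: "(\<Sum>i<CARD('d). (if i = 0 then p else q) + q) = 1 - r"
proof -
  have "(\<Sum>i<CARD('d). (if i = 0 then p else q) + q) = (\<Sum>i<CARD('d). 2 * q + (if i = 0 then p - q else 0))"
    by (intro sum.cong) auto
  also have "\<dots> = 2 * real CARD('d) * q + (p - q)" by (simp add: sum.distrib)
  also have "\<dots> = 1 - r" using pqr by (simp add: algebra_simps)
  finally show ?thesis .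
qed

lemma A_events:
  assumes "n \<ge> 1" shows "{\<omega> \<in> space M. A (n + 1) \<omega> = v} \<in> events"
proof -
  note [measurable] = A_rv[OF assms]
  show ?thesis by measurable
qed

lemma A_total:
  assumes "n \<ge> 1" shows "(\<Sum>v\<in>step_values. prob {\<omega> \<in> space M. A (n + 1) \<omega> = v}) = 1"
  using sum_weights by (simp add: sum_step_values A_prob[OF assms, simplified])

lemma finite_step_values: "finite step_values" by (simp add: step_values_def)

lemma AE_A_in_step_values: "n \<ge> 1 \<Longrightarrow> AE \<omega> in M. A (n + 1) \<omega> \<in> step_values"
  by (rule AE_finitely_supported[OF finite_step_values A_events A_total])

lemma expectation_A:
  assumes "n \<ge> 1" "f \<in> borel_measurable borel"
  shows "expectation (\<lambda>\<omega>. f (A (n + 1) \<omega>)) =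
    r * f 0 + (\<Sum>i<CARD('d). (if i = 0 then p else q) * f (signed_cyclic i 1) + q * f (signed_cyclic i (-1)))"
proof -
  have "expectation (\<lambda>\<omega>. f (A (n + 1) \<omega>)) = (\<Sum>v\<in>step_values. f v * prob {\<omega> \<in> space M. A (n + 1) \<omega> = v})"
    by (rule expectation_finitely_supported[OF finite_step_values A_events[OF assms(1)] A_total[OF assms(1)]])
      (rule measurable_compose[OF A_rv[OF assms(1)] assms(2)])
  also have "\<dots> = r * f 0 + (\<Sum>i<CARD('d). (if i = 0 then p else q) * f (signed_cyclic i 1) + q * f (signed_cyclic i (-1)))"
    unfolding sum_step_values
    by (intro arg_cong2[of _ _ _ _ "(+)"] sum.cong) (auto simp: A_prob[OF assms(1), simplified])
  finally show ?thesis .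
qed

lemma signed_cyclic_nth: "signed_cyclic i s $ a $ b = s * of_bool (b = (next_idx idx ^^ i) a)"
  by (simp add: mat_power_cyclic_nth[OF idx])

text \<open>A signed permutation matrix is orthogonal: distinct rows have their nonzero entries in distinct
  columns.\<close>

lemma signed_cyclic_row_product:
  "(\<Sum>b\<in>UNIV. signed_cyclic i s $ a $ b * signed_cyclic i s $ c $ b) = s\<^sup>2 * of_bool (a = c)"
proof -
  have "inj (next_idx idx ^^ i)" by (intro inj_fn inj_next_idx idx)
  then have eq: "(next_idx idx ^^ i) a = (next_idx idx ^^ i) c \<longleftrightarrow> a = c" by (auto dest: injD)
  have "(\<Sum>b\<in>UNIV. signed_cyclic i s $ a $ b * signed_cyclic i s $ c $ b) =
     (\<Sum>b\<in>UNIV. if b = (next_idx idx ^^ i) a then s\<^sup>2 * of_bool (b = (next_idx idx ^^ i) c) else 0)"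
    unfolding signed_cyclic_nth by (intro sum.cong) (auto simp: power2_eq_square)
  then show ?thesis using eq by simp
qed

lemma measurable_entry[measurable]: "(\<lambda>B :: real^'d^'d. B $ a $ b) \<in> borel_measurable borel"
  by (intro borel_measurable_continuous_onI continuous_intros)

text \<open>For every power except the zeroth, the two signs have the same weight and cancel.\<close>

lemma expectation_A_entry:
  assumes "n \<ge> 1"
  shows "expectation (\<lambda>\<omega>. A (n + 1) \<omega> $ a $ b) = (p - q) * of_bool (a = b)"
proof -
  have "expectation (\<lambda>\<omega>. A (n + 1) \<omega> $ a $ b) = r * (0 :: real^'d^'d) $ a $ b +
     (\<Sum>i<CARD('d). (if i = 0 then p else q) * signed_cyclic i 1 $ a $ b + q * signed_cyclic i (-1) $ a $ b)"
    by (rule expectation_A[OF assms measurable_entry])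
  also have "\<dots> = (\<Sum>i<CARD('d). if i = 0 then (p - q) * of_bool (a = b) else 0)"
  proof -
    have "(if i = 0 then p else q) * signed_cyclic i 1 $ a $ b + q * signed_cyclic i (-1) $ a $ b =
        (if i = 0 then (p - q) * of_bool (a = b) else 0)" for i
      unfolding signed_cyclic_nth by (cases "i = 0") (auto simp: algebra_simps)
    then show ?thesis by (simp only: zero_index mult_zero_right add_0)
  qed
  finally show ?thesis by simp
qed

lemma expectation_A_row_product:
  assumes "n \<ge> 1"
  shows "expectation (\<lambda>\<omega>. \<Sum>b\<in>UNIV. A (n + 1) \<omega> $ a $ b * A (n + 1) \<omega> $ c $ b) = (1 - r) * of_bool (a = c)"
proof -
  have "expectation (\<lambda>\<omega>. \<Sum>b\<in>UNIV. A (n + 1) \<omega> $ a $ b * A (n + 1) \<omega> $ c $ b) =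
     r * (\<Sum>b\<in>UNIV. (0 :: real^'d^'d) $ a $ b * (0 :: real^'d^'d) $ c $ b) +
     (\<Sum>i<CARD('d). (if i = 0 then p else q) * (\<Sum>b\<in>UNIV. signed_cyclic i 1 $ a $ b * signed_cyclic i 1 $ c $ b)
       + q * (\<Sum>b\<in>UNIV. signed_cyclic i (-1) $ a $ b * signed_cyclic i (-1) $ c $ b))"
    by (rule expectation_A[OF assms]) measurable
  also have "\<dots> = (\<Sum>i<CARD('d). ((if i = 0 then p else q) + q) * of_bool (a = c))"
    unfolding signed_cyclic_row_product by (auto intro!: sum.cong simp: algebra_simps)
  also have "\<dots> = (1 - r) * of_bool (a = c)"
    unfolding sum_distrib_right[symmetric] sum_weights ..
  finally show ?thesis .
qed

lemma step_values_entry_bound: "B \<in> step_values \<Longrightarrow> \<bar>B $ a $ b\<bar> \<le> 1"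
  by (auto simp: step_values_def mat_power_cyclic_nth[OF idx])

lemma step_values_mult_bound:
  assumes "B \<in> step_values" "\<And>a. \<bar>x $ a\<bar> \<le> 1"
  shows "\<bar>(B *v x) $ a\<bar> \<le> 1"
proof -
  have row: "(signed_cyclic i s *v x) $ a = s * x $ (next_idx idx ^^ i) a" for i s
  proof -
    have "(signed_cyclic i s *v x) $ a = (\<Sum>b\<in>UNIV. if b = (next_idx idx ^^ i) a then s * x $ b else 0)"
      unfolding matrix_vector_mult_def vec_lambda_beta signed_cyclic_nth by (intro sum.cong) auto
    then show ?thesis by simp
  qed
  from assms(1) consider "B = 0" | i s where "B = signed_cyclic i s" "\<bar>s\<bar> = 1"
    unfolding step_values_def by fastforce
  then show ?thesis
  proof cases
    case 1
    then show ?thesis by simp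
  next
    case (2 i s)
    have "\<bar>(B *v x) $ a\<bar> = \<bar>s\<bar> * \<bar>x $ (next_idx idx ^^ i) a\<bar>"
      unfolding 2(1) row abs_mult ..
    then show ?thesis using 2(2) assms(2) by simp
  qed
qed

end

section \<open>Conditioning the next step on the past\<close>

lemma measurable_coordinate[measurable]: "(\<lambda>x :: real^'d::finite. x $ a) \<in> borel_measurable borel"
  by (intro borel_measurable_continuous_onI continuous_intros)

context merws
begin

text \<open>The filtration as a measure space, so that \<open>borel_measurable (past n)\<close> expresses
  dependence on the first $n$ steps only.\<close>

definition past :: "nat \<Rightarrow> 'a measure" where
  "past n = sigma (space M) (history M X n)"

lemma history_subset: "history M X n \<subseteq> events"
  unfolding history_def
proof (rule sets.sigma_sets_subset, clarify)
  fix k S assume "k \<in> {1..n}" "S \<in> sigma_rv M borel (X k)"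
  then show "S \<in> events" using X_rv[of k] by (auto simp: sigma_rv_def intro: measurable_sets)
qed

lemma space_past[simp]: "space (past n) = space M"
  by (simp add: past_def space_measure_of_conv)

lemma sets_past: "sets (past n) = history M X n"
proof -
  have "(\<Union>k\<in>{1..n}. sigma_rv M borel (X k)) \<subseteq> Pow (space M)" by (auto simp: sigma_rv_def)
  then have "sigma_sets (space M) (history M X n) = history M X n"
    unfolding history_def by (rule sigma_sets_sigma_sets_eq)
  moreover have "history M X n \<subseteq> Pow (space M)" using history_subset sets.sets_into_space by blast
  ultimately show ?thesis by (simp add: past_def)
qed

lemma subalgebra_past: "subalgebra M (past n)"
  using history_subset by (simp add: subalgebra_def sets_past)

lemma past_mono: "m \<le> n \<Longrightarrow> sets (past m) \<subseteq> sets (past n)"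
  unfolding sets_past history_def by (rule sigma_sets_mono') (rule UN_mono, auto)

lemma X_past: "k \<in> {1..n} \<Longrightarrow> X k \<in> borel_measurable (past n)"
proof (rule measurableI)
  fix B :: "(real^'d) set" assume k: "k \<in> {1..n}" and B: "B \<in> sets borel"
  have "X k -` B \<inter> space M \<in> sigma_rv M borel (X k)" using B by (auto simp: sigma_rv_def)
  then show "X k -` B \<inter> space (past n) \<in> sets (past n)"
    unfolding sets_past history_def space_past by (intro sigma_sets.Basic) (rule UN_I[OF k])
qed simp

lemma walk_nth: "walk X n \<omega> $ a = (\<Sum>k=1..n. X k \<omega> $ a)"
  by (simp add: walk_def)

lemma walk_Suc: "walk X (Suc n) \<omega> = walk X n \<omega> + X (Suc n) \<omega>"
  by (simp add: walk_def)

lemma walk_past: "walk X n \<in> borel_measurable (past n)"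
  unfolding walk_def by (intro borel_measurable_sum X_past)

lemma U_events: "n \<ge> 1 \<Longrightarrow> {\<omega> \<in> space M. U (n + 1) \<omega> = k} \<in> events"
  using measurable_sets[OF U_rv, of n "{k}"] by (simp add: vimage_def Int_def conj_commute)

lemma AE_U:
  assumes n: "n \<ge> 1"
  shows "AE \<omega> in M. U (n + 1) \<omega> \<in> {1..n}"
proof (rule AE_finitely_supported[OF _ U_events[OF n]])
  have "(\<Sum>k=1..n. prob {\<omega> \<in> space M. U (n + 1) \<omega> = k}) = (\<Sum>k=1..n. 1 / real n)"
    by (intro sum.cong refl U_law[OF n])
  then show "(\<Sum>k=1..n. prob {\<omega> \<in> space M. U (n + 1) \<omega> = k}) = 1" using n by simp
qed simp

lemma initial_law:
  shows AE_X1: "AE \<omega> in M. X 1 \<omega> \<in> (\<lambda>(i, s). s *\<^sub>R axis i 1) ` (UNIV \<times> {1, -1})"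
    and expectation_X1: "f \<in> borel_measurable borel \<Longrightarrow> expectation (\<lambda>\<omega>. f (X 1 \<omega>)) =
      (\<Sum>i\<in>UNIV. f (axis i 1) + f (- axis i 1)) / (2 * real CARD('d))"
proof -
  let ?v = "\<lambda>(i :: 'd, s :: real). s *\<^sub>R (axis i 1 :: real^'d)"
  let ?V = "?v ` (UNIV \<times> {1, -1})"
  have inj: "inj_on ?v (UNIV \<times> {1, -1})"
  proof (rule inj_onI, clarify)
    fix i j :: 'd and s t :: real
    assume s: "s \<in> {1, -1}" "t \<in> {1, -1}" and eq: "s *\<^sub>R (axis i 1 :: real^'d) = t *\<^sub>R axis j 1"
    have "s = t * of_bool (i = j)"
      using arg_cong[OF eq, of "\<lambda>x. x $ i"] by (simp add: axis_def)
    then show "i = j \<and> s = t" using s by (auto simp: of_bool_def split: if_splits)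
  qed
  have sum: "(\<Sum>v\<in>?V. g v) = (\<Sum>i\<in>UNIV. g (axis i 1) + g (- axis i 1))" for g :: "_ \<Rightarrow> real"
  proof -
    have "(\<Sum>v\<in>?V. g v) = (\<Sum>(i, s)\<in>UNIV \<times> {1, -1}. g (s *\<^sub>R axis i 1))"
      unfolding sum.reindex[OF inj] by (intro sum.cong) auto
    also have "\<dots> = (\<Sum>i\<in>UNIV. g (axis i 1) + g (- axis i 1))"
      by (subst sum.cartesian_product[symmetric]) simp
    finally show ?thesis .
  qed
  have prob: "prob {\<omega> \<in> space M. X 1 \<omega> = axis i 1} = 1 / (2 * real CARD('d))"
    "prob {\<omega> \<in> space M. X 1 \<omega> = - axis i 1} = 1 / (2 * real CARD('d))" for i
  proof -
    obtain k where k: "k \<in> {1..CARD('d)}" "i = idx k" by (rule idx_cases[OF idx])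
    show "prob {\<omega> \<in> space M. X 1 \<omega> = axis i 1} = 1 / (2 * real CARD('d))"
      "prob {\<omega> \<in> space M. X 1 \<omega> = - axis i 1} = 1 / (2 * real CARD('d))"
      using X1_law[OF k(1), of 1] X1_law[OF k(1), of "-1"] k(2) by simp_all
  qed
  have ev: "{\<omega> \<in> space M. X 1 \<omega> = v} \<in> events" for v
  proof -
    note [measurable] = X_rv[OF order_refl]
    show ?thesis by measurable
  qed
  have fin: "finite ?V" by simp
  have total: "(\<Sum>v\<in>?V. prob {\<omega> \<in> space M. X 1 \<omega> = v}) = 1"
    unfolding sum prob by simp
  show "AE \<omega> in M. X 1 \<omega> \<in> ?V" by (rule AE_finitely_supported[OF fin ev total])
  assume f: "f \<in> borel_measurable borel"
  have "expectation (\<lambda>\<omega>. f (X 1 \<omega>)) = (\<Sum>v\<in>?V. f v * prob {\<omega> \<in> space M. X 1 \<omega> = v})"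
    by (rule expectation_finitely_supported[OF fin ev total])
      (rule measurable_compose[OF X_rv[OF order_refl] f])
  then show "expectation (\<lambda>\<omega>. f (X 1 \<omega>)) = (\<Sum>i\<in>UNIV. f (axis i 1) + f (- axis i 1)) / (2 * real CARD('d))"
    unfolding sum prob by (simp add: sum_divide_distrib add_divide_distrib)
qed

text \<open>Almost surely the step matrix is zero or a signed permutation matrix, so it never increases the
  largest coordinate.  This makes all moments below finite.\<close>

lemma AE_X_bound: "n \<ge> 1 \<Longrightarrow> AE \<omega> in M. \<forall>a. \<bar>X n \<omega> $ a\<bar> \<le> 1"
proof (induction n rule: less_induct)
  case (less n)
  show ?case
  proof (cases "n = 1")
    case True
    show ?thesis unfolding True using AE_X1
      by eventually_elim (auto simp: axis_def)
  next
    case False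
    then obtain m where m: "n = m + 1" "m \<ge> 1" using less.prems by (cases n) auto
    have "AE \<omega> in M. \<forall>k\<in>{1..m}. \<forall>a. \<bar>X k \<omega> $ a\<bar> \<le> 1"
      by (intro AE_finite_allI less.IH) (use m in auto)
    then show ?thesis using AE_A_in_step_values[OF m(2)] AE_U[OF m(2)] AE_space
    proof eventually_elim
      case (elim \<omega>)
      then show ?case
        unfolding m(1) X_step[OF m(2) elim(4)] by (auto intro!: step_values_mult_bound)
    qed
  qed
qed

lemma sq_integrable_X: "n \<ge> 1 \<Longrightarrow> sq_integrable M (\<lambda>\<omega>. X n \<omega> $ a)"
  using AE_X_bound[of n] X_rv[of n]
  by (intro sq_integrable_bounded[of _ 1]) (auto elim: eventually_mono)

lemma sq_integrable_walk: "sq_integrable M (\<lambda>\<omega>. walk X n \<omega> $ a)"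
proof (induction n)
  case 0
  show ?case using sq_integrable_const[of 0] by (simp add: walk_def)
next
  case (Suc n)
  then show ?case using sq_integrable_X[of "Suc n" a] by (simp add: walk_Suc sq_integrable_add)
qed

lemma integrable_mult_X:
  assumes "integrable M Z" "n \<ge> 1"
  shows "integrable M (\<lambda>\<omega>. Z \<omega> * X n \<omega> $ a)"
proof (rule Bochner_Integration.integrable_bound[OF assms(1)])
  note [measurable] = X_rv[OF assms(2)]
  show "(\<lambda>\<omega>. Z \<omega> * X n \<omega> $ a) \<in> borel_measurable M" using assms(1) by measurable
  show "AE \<omega> in M. norm (Z \<omega> * X n \<omega> $ a) \<le> norm (Z \<omega>)"
    using AE_X_bound[OF assms(2)]
    by eventually_elim (auto simp: abs_mult intro: mult_left_le)
qed

text \<open>The form in which independence is used: the three factors of a summand of the next step, namely a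
  function of the matrix, the indicator of the remembered time and a function of the past, have
  expectations that multiply.\<close>

lemma indep_expectation:
  assumes n: "n \<ge> 1" and f: "f \<in> borel_measurable borel" "integrable M (\<lambda>\<omega>. f (A (n + 1) \<omega>))"
    and k: "k \<in> {1..n}" and Z: "Z \<in> borel_measurable (past n)" "integrable M Z"
  shows "integrable M (\<lambda>\<omega>. f (A (n + 1) \<omega>) * indicator {k} (U (n + 1) \<omega>) * Z \<omega>)" (is ?int)
    and "expectation (\<lambda>\<omega>. f (A (n + 1) \<omega>) * indicator {k} (U (n + 1) \<omega>) * Z \<omega>) =
      expectation (\<lambda>\<omega>. f (A (n + 1) \<omega>)) / real n * expectation Z" (is ?eq)
proof -
  define W where "W i = [\<lambda>\<omega>. f (A (n + 1) \<omega>), \<lambda>\<omega>. indicator {k} (U (n + 1) \<omega>), Z] ! i" for i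
  have W: "W 0 = (\<lambda>\<omega>. f (A (n + 1) \<omega>))" "W 1 = (\<lambda>\<omega>. indicator {k} (U (n + 1) \<omega>))" "W 2 = Z"
    by (simp_all add: W_def)
  have I: "{..<3} = {0, 1, 2::nat}" by auto
  have indU: "(\<lambda>\<omega>. indicator {k} (U (n + 1) \<omega>) :: real) = indicator {\<omega>. U (n + 1) \<omega> = k}"
    by (auto simp: indicator_def)
  have U_int: "integrable M (W 1)" "expectation (W 1) = 1 / real n"
  proof -
    have *: "{\<omega>. U (n + 1) \<omega> = k} \<inter> space M = {\<omega> \<in> space M. U (n + 1) \<omega> = k}" by auto
    show "integrable M (W 1)" unfolding W indU
      by (subst integrable_indicator_iff) (use U_events[OF n, of k] * in \<open>simp add: less_top[symmetric]\<close>)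
    show "expectation (W 1) = 1 / real n" unfolding W indU
      using U_law[OF n k] * by simp
  qed
  have rv: "random_variable borel (W i)" if "i \<in> {..<3}" for i
    using that U_int(1) f(2) Z(2) unfolding I by (auto simp: W(1,3) simp del: One_nat_def)
  have "indep_vars (\<lambda>_. borel) W {..<3}"
    unfolding indep_vars_def2
  proof (intro conjI ballI rv)
    show "indep_sets (\<lambda>i. {W i -` B \<inter> space M |B. B \<in> sets borel}) {..<3}"
    proof (rule indep_sets_mono_sets[OF indep[OF n]])
      fix i assume "i \<in> {..<3::nat}"
      then consider "i = 0" | "i = 1" | "i = 2" unfolding I by blast
      then show "{W i -` B \<inter> space M |B. B \<in> sets borel} \<subseteq>
        [sigma_rv M borel (A (n + 1)), sigma_rv M (count_space UNIV) (U (n + 1)), history M X n] ! i"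
      proof cases
        case 1
        have "\<exists>C. W 0 -` B \<inter> space M = A (n + 1) -` C \<inter> space M \<and> C \<in> sets borel" if "B \<in> sets borel" for B
          using measurable_sets[OF f(1) that] by (intro exI[of _ "f -` B"]) (auto simp: W)
        then show ?thesis unfolding 1 by (auto simp: sigma_rv_def)
      next
        case 2
        have "\<exists>C. W 1 -` B \<inter> space M = U (n + 1) -` C \<inter> space M" for B
          by (intro exI[of _ "indicator {k} -` B"]) (auto simp: W simp del: One_nat_def)
        then show ?thesis unfolding 2 by (auto simp: sigma_rv_def simp del: One_nat_def)
      next
        case 3
        show ?thesis unfolding 3 using measurable_sets[OF Z(1)] by (auto simp: W sets_past)
      qed
    qed
  qed
  moreover have "integrable M (W i)" if "i \<in> {..<3}" for i
    using that U_int(1) f(2) Z(2) unfolding I by (auto simp: W(1,3) simp del: One_nat_def)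
  ultimately have "integrable M (\<lambda>\<omega>. \<Prod>i<3. W i \<omega>)"
    "expectation (\<lambda>\<omega>. \<Prod>i<3. W i \<omega>) = (\<Prod>i<3. expectation (W i))"
    by (auto intro: indep_vars_integrable indep_vars_lebesgue_integral)
  moreover have "(\<Prod>i<3. g i) = g 0 * g 1 * g 2" for g :: "nat \<Rightarrow> real"
    unfolding I by (simp add: mult.assoc)
  ultimately have prod: "integrable M (\<lambda>\<omega>. W 0 \<omega> * W 1 \<omega> * W 2 \<omega>)"
    "expectation (\<lambda>\<omega>. W 0 \<omega> * W 1 \<omega> * W 2 \<omega>) = expectation (W 0) * expectation (W 1) * expectation (W 2)"
    by (simp_all only:)
  show ?int using prod(1) unfolding W .
  show ?eq using prod(2) unfolding U_int(2) unfolding W by simp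
qed

text \<open>Splitting according to the remembered time turns the random index into a finite sum of products to
  which independence applies.\<close>

lemma X_expansion:
  assumes n: "n \<ge> 1"
  shows "AE \<omega> in M. \<forall>a. X (n + 1) \<omega> $ a =
    (\<Sum>k=1..n. \<Sum>b\<in>UNIV. A (n + 1) \<omega> $ a $ b * indicator {k} (U (n + 1) \<omega>) * X k \<omega> $ b)"
  using AE_U[OF n] AE_space
proof eventually_elim
  case (elim \<omega>)
  have "(\<Sum>k=1..n. \<Sum>b\<in>UNIV. A (n + 1) \<omega> $ a $ b * indicator {k} (U (n + 1) \<omega>) * X k \<omega> $ b) =
    (\<Sum>k=1..n. if k = U (n + 1) \<omega> then \<Sum>b\<in>UNIV. A (n + 1) \<omega> $ a $ b * X k \<omega> $ b else 0)" for a
    by (intro sum.cong) (auto simp: indicator_def)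
  then show ?case using elim(1) unfolding X_step[OF n elim(2)]
    by (simp add: matrix_vector_mult_def)
qed

lemma integrable_A_entry: "n \<ge> 1 \<Longrightarrow> integrable M (\<lambda>\<omega>. A (n + 1) \<omega> $ a $ b)"
  using AE_A_in_step_values[of n] A_rv[of n]
  by (intro integrable_const_bound[of _ 1]) (auto elim!: eventually_mono intro: step_values_entry_bound)

lemma integrable_A_entry_product:
  "n \<ge> 1 \<Longrightarrow> integrable M (\<lambda>\<omega>. A (n + 1) \<omega> $ a $ b * A (n + 1) \<omega> $ c $ e)"
  using AE_A_in_step_values[of n] A_rv[of n]
  by (intro integrable_const_bound[of _ 1])
    (auto elim!: eventually_mono intro!: mult_le_one step_values_entry_bound simp: abs_mult)

text \<open>In the expansion of the next step only the diagonal entries of $E[A] = (p - q) I$ survive, each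
  remembered time having weight $1/n$.  As $Z$ ranges over functions of the past, this says that the
  conditional mean of $X_{n+1}$ is $(p - q) S_n / n$.\<close>

lemma conditional_mean:
  assumes n: "n \<ge> 1" and Z: "Z \<in> borel_measurable (past n)" "integrable M Z"
  shows "expectation (\<lambda>\<omega>. Z \<omega> * X (n + 1) \<omega> $ a) = (p - q) / real n * expectation (\<lambda>\<omega>. Z \<omega> * walk X n \<omega> $ a)"
proof -
  let ?t = "\<lambda>k b \<omega>. A (n + 1) \<omega> $ a $ b * indicator {k} (U (n + 1) \<omega>) * (Z \<omega> * X k \<omega> $ b)"
  have ZX: "(\<lambda>\<omega>. Z \<omega> * X k \<omega> $ b) \<in> borel_measurable (past n)" "integrable M (\<lambda>\<omega>. Z \<omega> * X k \<omega> $ b)"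
    if "k \<in> {1..n}" for k b
  proof -
    note [measurable] = X_past[OF that] Z(1)
    show "(\<lambda>\<omega>. Z \<omega> * X k \<omega> $ b) \<in> borel_measurable (past n)" by measurable
    show "integrable M (\<lambda>\<omega>. Z \<omega> * X k \<omega> $ b)" using that by (intro integrable_mult_X Z) auto
  qed
  have t_int: "integrable M (?t k b)"
    and t_eq: "expectation (?t k b) = (p - q) * of_bool (a = b) / real n * expectation (\<lambda>\<omega>. Z \<omega> * X k \<omega> $ b)"
    if "k \<in> {1..n}" for k b
    using indep_expectation[OF n measurable_entry integrable_A_entry[OF n] that ZX[OF that], of a b b]
    by (simp_all add: expectation_A_entry[OF n, simplified])
  have "expectation (\<lambda>\<omega>. Z \<omega> * X (n + 1) \<omega> $ a) = expectation (\<lambda>\<omega>. \<Sum>k=1..n. \<Sum>b\<in>UNIV. ?t k b \<omega>)"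
  proof (rule integral_cong_AE)
    show "(\<lambda>\<omega>. Z \<omega> * X (n + 1) \<omega> $ a) \<in> borel_measurable M"
      using integrable_mult_X[OF Z(2), of "n + 1" a] by simp
    show "(\<lambda>\<omega>. \<Sum>k=1..n. \<Sum>b\<in>UNIV. ?t k b \<omega>) \<in> borel_measurable M"
      by (intro borel_measurable_integrable Bochner_Integration.integrable_sum t_int)
    show "AE \<omega> in M. Z \<omega> * X (n + 1) \<omega> $ a = (\<Sum>k=1..n. \<Sum>b\<in>UNIV. ?t k b \<omega>)"
      using X_expansion[OF n]
      by eventually_elim (simp add: sum_distrib_left mult.left_commute mult.assoc)
  qed
  also have "\<dots> = (\<Sum>k=1..n. \<Sum>b\<in>UNIV. expectation (?t k b))"
    by (subst Bochner_Integration.integral_sum)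
      (auto intro!: sum.cong Bochner_Integration.integral_sum Bochner_Integration.integrable_sum t_int simp del: One_nat_def)
  also have "\<dots> = (\<Sum>k=1..n. \<Sum>b\<in>UNIV. if b = a then (p - q) / real n * expectation (\<lambda>\<omega>. Z \<omega> * X k \<omega> $ b) else 0)"
    by (intro sum.cong refl) (auto simp: t_eq simp del: One_nat_def)
  also have "\<dots> = (p - q) / real n * (\<Sum>k=1..n. expectation (\<lambda>\<omega>. Z \<omega> * X k \<omega> $ a))"
    by (simp add: sum_distrib_left)
  also have "(\<Sum>k=1..n. expectation (\<lambda>\<omega>. Z \<omega> * X k \<omega> $ a)) = expectation (\<lambda>\<omega>. Z \<omega> * walk X n \<omega> $ a)"
    unfolding walk_nth sum_distrib_left
    by (rule Bochner_Integration.integral_sum[symmetric]) (rule ZX(2))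
  finally show ?thesis .
qed

text \<open>If the covariance of $X_k$ is $v_k I$, then conditionally on remembering time $k$ the covariance of
  the next step is $v_k E[A A^T] = (1 - r) v_k I$.  Averaging over $k$ keeps it a multiple of $I$.\<close>

lemma isotropic_step:
  assumes n: "n \<ge> 1"
    and iso: "\<And>k a c. k \<in> {1..n} \<Longrightarrow> expectation (\<lambda>\<omega>. X k \<omega> $ a * X k \<omega> $ c) = v k * of_bool (a = c)"
  shows "expectation (\<lambda>\<omega>. X (n + 1) \<omega> $ a * X (n + 1) \<omega> $ c) = (1 - r) / real n * (\<Sum>k=1..n. v k) * of_bool (a = c)"
proof -
  let ?t = "\<lambda>k b e \<omega>. A (n + 1) \<omega> $ a $ b * A (n + 1) \<omega> $ c $ e * indicator {k} (U (n + 1) \<omega>) * (X k \<omega> $ b * X k \<omega> $ e)"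
  have XX: "(\<lambda>\<omega>. X k \<omega> $ b * X k \<omega> $ e) \<in> borel_measurable (past n)" "integrable M (\<lambda>\<omega>. X k \<omega> $ b * X k \<omega> $ e)"
    if "k \<in> {1..n}" for k b e
  proof -
    note [measurable] = X_past[OF that]
    show "(\<lambda>\<omega>. X k \<omega> $ b * X k \<omega> $ e) \<in> borel_measurable (past n)" by measurable
    show "integrable M (\<lambda>\<omega>. X k \<omega> $ b * X k \<omega> $ e)" using that by (intro sq_integrable_mult sq_integrable_X) auto
  qed
  let ?m = "\<lambda>b e. expectation (\<lambda>\<omega>. A (n + 1) \<omega> $ a $ b * A (n + 1) \<omega> $ c $ e)"
  have t_int: "integrable M (?t k b e)"
    and t_eq: "expectation (?t k b e) = ?m b e / real n * (v k * of_bool (b = e))"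
    if "k \<in> {1..n}" for k b e
    using indep_expectation[OF n _ integrable_A_entry_product[OF n] that XX[OF that], of a b c e b e]
    by (simp_all add: iso[OF that])
  have "expectation (\<lambda>\<omega>. X (n + 1) \<omega> $ a * X (n + 1) \<omega> $ c) =
      expectation (\<lambda>\<omega>. \<Sum>k=1..n. \<Sum>b\<in>UNIV. \<Sum>e\<in>UNIV. ?t k b e \<omega>)"
  proof (rule integral_cong_AE)
    show "(\<lambda>\<omega>. X (n + 1) \<omega> $ a * X (n + 1) \<omega> $ c) \<in> borel_measurable M"
      using X_rv[of "n + 1"] by measurable
    show "(\<lambda>\<omega>. \<Sum>k=1..n. \<Sum>b\<in>UNIV. \<Sum>e\<in>UNIV. ?t k b e \<omega>) \<in> borel_measurable M"
      by (intro borel_measurable_integrable Bochner_Integration.integrable_sum t_int)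
    show "AE \<omega> in M. X (n + 1) \<omega> $ a * X (n + 1) \<omega> $ c = (\<Sum>k=1..n. \<Sum>b\<in>UNIV. \<Sum>e\<in>UNIV. ?t k b e \<omega>)"
      using AE_U[OF n] AE_space
    proof eventually_elim
      case (elim \<omega>)
      have "(\<Sum>k=1..n. \<Sum>b\<in>UNIV. \<Sum>e\<in>UNIV. ?t k b e \<omega>) =
        (\<Sum>k=1..n. if k = U (n + 1) \<omega> then \<Sum>b\<in>UNIV. \<Sum>e\<in>UNIV.
          (A (n + 1) \<omega> $ a $ b * X k \<omega> $ b) * (A (n + 1) \<omega> $ c $ e * X k \<omega> $ e) else 0)"
        by (intro sum.cong) (auto simp: indicator_def mult_ac)
      then show ?case using elim(1) unfolding X_step[OF n elim(2)]
        by (simp add: matrix_vector_mult_def sum_product)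
    qed
  qed
  also have "\<dots> = (\<Sum>k=1..n. \<Sum>b\<in>UNIV. \<Sum>e\<in>UNIV. expectation (?t k b e))"
    by (simp add: Bochner_Integration.integral_sum Bochner_Integration.integrable_sum t_int del: One_nat_def)
  also have "\<dots> = (\<Sum>k=1..n. \<Sum>b\<in>UNIV. \<Sum>e\<in>UNIV. if e = b then v k / real n * ?m b e else 0)"
    by (intro sum.cong refl) (auto simp: t_eq simp del: One_nat_def)
  also have "\<dots> = (\<Sum>k=1..n. v k / real n * (\<Sum>b\<in>UNIV. ?m b b))"
    by (simp add: sum_distrib_left)
  also have "(\<Sum>b\<in>UNIV. ?m b b) = (1 - r) * of_bool (a = c)"
    unfolding expectation_A_row_product[OF n, symmetric]
    by (rule Bochner_Integration.integral_sum[symmetric]) (rule integrable_A_entry_product[OF n])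
  also have "(\<Sum>k=1..n. v k / real n * ((1 - r) * of_bool (a = c))) = (1 - r) / real n * (\<Sum>k=1..n. v k) * of_bool (a = c)"
    by (simp add: sum_distrib_left sum_distrib_right sum_divide_distrib mult_ac)
  finally show ?thesis .
qed

end

section \<open>First and second moments of the walk\<close>

context merws
begin

text \<open>Increments of the sequence $\prod_{k<n} (1 + (1-r)/k) / d$, the expected squared length
  accumulated by one coordinate; the first increment is its first value $1/d$.\<close>

definition step_var :: "nat \<Rightarrow> real" where
  "step_var k = (growth (1 - r) k - (if k = 1 then 0 else growth (1 - r) (k - 1))) / real CARD('d)"

lemma sum_step_var: "n \<ge> 1 \<Longrightarrow> (\<Sum>k=1..n. step_var k) = growth (1 - r) n / real CARD('d)"
proof (induction n rule: nat_induct_at_least)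
  case (Suc n)
  then show ?case by (simp add: step_var_def diff_divide_distrib del: growth.simps)
qed (simp add: step_var_def)

lemma step_var_Suc: "n \<ge> 1 \<Longrightarrow> step_var (n + 1) = (1 - r) / real n * (\<Sum>k=1..n. step_var k)"
  unfolding sum_step_var by (simp add: step_var_def field_simps)

lemma step_covariance:
  "n \<ge> 1 \<Longrightarrow> expectation (\<lambda>\<omega>. X n \<omega> $ a * X n \<omega> $ c) = step_var n * of_bool (a = c)"
proof (induction n arbitrary: a c rule: less_induct)
  case (less n)
  show ?case
  proof (cases "n = 1")
    case True
    have "expectation (\<lambda>\<omega>. X 1 \<omega> $ a * X 1 \<omega> $ c) =
        (\<Sum>i\<in>UNIV. axis i 1 $ a * axis i 1 $ c + (- axis i 1) $ a * (- axis i 1) $ c) / (2 * real CARD('d))"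
      by (rule expectation_X1) measurable
    also have "\<dots> = (\<Sum>i\<in>UNIV. if i = a then 2 * of_bool (a = c) else 0) / (2 * real CARD('d))"
      by (intro arg_cong2[of _ _ _ _ "(/)"] sum.cong) (auto simp: axis_def)
    finally show ?thesis by (simp add: True step_var_def)
  next
    case False
    then obtain m where m: "n = m + 1" "m \<ge> 1" using less.prems by (cases n) auto
    show ?thesis unfolding m(1) step_var_Suc[OF m(2)]
      by (rule isotropic_step[OF m(2) less.IH]) (use m in auto)
  qed
qed

text \<open>The solution of $s_{n+1} = (1 + 2(p-q)/n) s_n + (1-r) t_n / n$ with $s_1 = t_1 = 1/d$, where
  $t_{n+1} = (1 + (1-r)/n) t_n$: a particular solution is a multiple of $t_n$, and the homogeneous
  one grows like $n^{2(p-q)}$.\<close>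

definition walk_var :: "nat \<Rightarrow> real" where
  "walk_var n = (2 * (p - q) * growth (2 * (p - q)) n - (1 - r) * growth (1 - r) n) /
     ((2 * (p - q) - (1 - r)) * real CARD('d))"

text \<open>Expand $(S_n + X_{n+1})(S_n + X_{n+1})^T$.  By the conditional mean each mixed term contributes
  $(p-q)/n$ times the covariance of $S_n$, and the last term is the step covariance; the variances
  therefore satisfy the recursion solved by \<open>walk_var\<close>.\<close>

lemma walk_covariance:
  assumes super: "2 * (p - q) > 1 - r"
  shows "n \<ge> 1 \<Longrightarrow> expectation (\<lambda>\<omega>. walk X n \<omega> $ a * walk X n \<omega> $ c) = walk_var n * of_bool (a = c)"
proof (induction n arbitrary: a c rule: nat_induct_at_least)
  case base
  then show ?case using step_covariance[of 1 a c] super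
    by (simp add: walk_def walk_var_def step_var_def)
next
  case (Suc n)
  have past: "(\<lambda>\<omega>. walk X n \<omega> $ a) \<in> borel_measurable (past n)" for a
    using walk_past[of n] by measurable
  have cross: "expectation (\<lambda>\<omega>. walk X n \<omega> $ a * X (Suc n) \<omega> $ c) = (p - q) / real n * (walk_var n * of_bool (a = c))" for a c
    using conditional_mean[OF Suc.hyps past sq_integrable_integrable[OF sq_integrable_walk], of a c] Suc.IH by simp
  have step: "expectation (\<lambda>\<omega>. X (Suc n) \<omega> $ a * X (Suc n) \<omega> $ c) =
      (1 - r) / real n * (growth (1 - r) n / real CARD('d)) * of_bool (a = c)" for a c
    using step_covariance[of "Suc n" a c] step_var_Suc[OF Suc.hyps] sum_step_var[OF Suc.hyps] by simp
  have var: "(1 - r) / real n * (growth (1 - r) n / real CARD('d)) + 2 * (p - q) / real n * walk_var n + walk_var n = walk_var (Suc n)"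
  proof -
    define b y g h D N where "b = 1 - r" and "y = 2 * (p - q)" and "g = growth (1 - r) n" and "h = growth (2 * (p - q)) n"
      and "D = real CARD('d)" and "N = real n"
    have nz: "y - b \<noteq> 0" "D \<noteq> 0" "N \<noteq> 0" using super Suc.hyps by (auto simp: y_def b_def D_def N_def)
    have "b / N * (g / D) + y / N * ((y * h - b * g) / ((y - b) * D)) + (y * h - b * g) / ((y - b) * D)
      = (y * ((1 + y / N) * h) - b * ((1 + b / N) * g)) / ((y - b) * D)"
      using nz by (simp add: divide_simps) (simp add: algebra_simps)
    then show ?thesis by (simp add: walk_var_def b_def y_def g_def h_def D_def N_def)
  qed
  have "expectation (\<lambda>\<omega>. walk X (Suc n) \<omega> $ a * walk X (Suc n) \<omega> $ c) =
    expectation (\<lambda>\<omega>. walk X n \<omega> $ a * walk X n \<omega> $ c + walk X n \<omega> $ a * X (Suc n) \<omega> $ c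
      + walk X n \<omega> $ c * X (Suc n) \<omega> $ a + X (Suc n) \<omega> $ a * X (Suc n) \<omega> $ c)"
    by (intro Bochner_Integration.integral_cong) (auto simp: walk_Suc algebra_simps)
  also have "\<dots> = expectation (\<lambda>\<omega>. walk X n \<omega> $ a * walk X n \<omega> $ c) + expectation (\<lambda>\<omega>. walk X n \<omega> $ a * X (Suc n) \<omega> $ c)
      + expectation (\<lambda>\<omega>. walk X n \<omega> $ c * X (Suc n) \<omega> $ a) + expectation (\<lambda>\<omega>. X (Suc n) \<omega> $ a * X (Suc n) \<omega> $ c)"
    using sq_integrable_mult[OF sq_integrable_walk sq_integrable_walk, of n a n c]
      sq_integrable_mult[OF sq_integrable_walk sq_integrable_X, of "Suc n" n a c]
      sq_integrable_mult[OF sq_integrable_walk sq_integrable_X, of "Suc n" n c a]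
      sq_integrable_mult[OF sq_integrable_X sq_integrable_X, of "Suc n" "Suc n" a c]
    by simp
  also have "\<dots> = ((1 - r) / real n * (growth (1 - r) n / real CARD('d)) + 2 * (p - q) / real n * walk_var n + walk_var n) * of_bool (a = c)"
    unfolding Suc.IH cross step using Suc.hyps by (cases "a = c") (simp_all add: field_simps)
  finally show ?case unfolding var .
qed

lemma walk_mean: "n \<ge> 1 \<Longrightarrow> expectation (\<lambda>\<omega>. walk X n \<omega> $ a) = 0"
proof (induction n rule: nat_induct_at_least)
  case base
  have "expectation (\<lambda>\<omega>. X 1 \<omega> $ a) = (\<Sum>i\<in>UNIV. axis i 1 $ a + (- axis i 1) $ a) / (2 * real CARD('d))"
    by (rule expectation_X1) measurable
  then show ?case by (simp add: walk_def)
next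
  case (Suc n)
  have "expectation (\<lambda>\<omega>. X (Suc n) \<omega> $ a) = 0"
  proof -
    have "expectation (\<lambda>\<omega>. 1 * X (n + 1) \<omega> $ a) = (p - q) / real n * expectation (\<lambda>\<omega>. 1 * walk X n \<omega> $ a)"
      by (rule conditional_mean[OF Suc.hyps]) auto
    then show ?thesis by (simp add: Suc.IH)
  qed
  then show ?case
    using sq_integrable_integrable[OF sq_integrable_walk, of n a] sq_integrable_integrable[OF sq_integrable_X, of "Suc n" a]
    by (simp add: walk_Suc Suc.IH)
qed

text \<open>The exponent $2(p-q)$ exceeds $1-r$, so only the homogeneous solution contributes, and
  $\Gamma(1 + y) = y \Gamma(y)$ absorbs its coefficient.\<close>

lemma walk_var_asymptotics:
  assumes super: "2 * (p - q) > 1 - r"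
  shows "(\<lambda>n. walk_var n / real n powr (2 * (p - q))) \<longlonglongrightarrow>
    1 / (real CARD('d) * (2 * (p - q) - (1 - r)) * Gamma (2 * (p - q)))"
proof -
  let ?y = "2 * (p - q)" and ?b = "1 - r"
  have b: "0 < ?b" using r_range by simp
  have "(\<lambda>n. (?y * (growth ?y n / real n powr ?y) - ?b * (growth ?b n / real n powr ?y)) / ((?y - ?b) * real CARD('d)))
    \<longlonglongrightarrow> (?y * (1 / Gamma (1 + ?y)) - ?b * 0) / ((?y - ?b) * real CARD('d))"
    by (intro tendsto_divide tendsto_diff tendsto_mult tendsto_const growth_asymptotics growth_smaller_power)
      (use super b in auto)
  moreover have "(y * g - b * h) / D / P = (y * (g / P) - b * (h / P)) / D" for y g b h D P :: real
    by (simp add: diff_divide_distrib mult.commute)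
  moreover have "Gamma (1 + ?y) = ?y * Gamma ?y"
    by (rule Gamma_recurrence_pos) (use super b in simp)
  moreover have "(y * (1 / (y * G)) - ?b * 0) / ((y - ?b) * D) = 1 / (D * (y - ?b) * G)"
    if "y \<noteq> 0" for y G D :: real
    using that by (simp add: mult_ac)
  ultimately show ?thesis
    using super b by (simp only: walk_var_def)
qed

end

section \<open>The limit in the superdiffusive regime\<close>

context merws
begin

text \<open>Eliminating $q$ by $p + (2d-1) q + r = 1$ shows that the factor of the denominator of $\vartheta^2$
  which contains $p$ is $2d - 1$ times the gap $2(p-q) - (1-r)$ between the two growth exponents.\<close>

lemma superdiffusive_gap:
  "4 * real CARD('d) * p - (2 * real CARD('d) + 1) * (1 - r) =
    (2 * real CARD('d) - 1) * (2 * (p - q) - (1 - r))"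
  using pqr by (simp add: algebra_simps)

lemma card_ge_1: "real CARD('d) \<ge> 1"
  using zero_less_card_finite[where 'a = 'd] by linarith

lemma superdiffusive:
  assumes "p > p_crit CARD('d) r"
  shows "2 * (p - q) > 1 - r"
proof -
  have "4 * real CARD('d) * p - (2 * real CARD('d) + 1) * (1 - r) > 0"
    using assms card_ge_1 by (simp add: p_crit_def field_simps)
  then have "(2 * real CARD('d) - 1) * (2 * (p - q) - (1 - r)) > 0"
    unfolding superdiffusive_gap .
  then show ?thesis using card_ge_1 by (simp add: zero_less_mult_iff)
qed

definition limit_var :: real where
  "limit_var = 1 / (real CARD('d) * (2 * (p - q) - (1 - r)) * Gamma (2 * (p - q)))"

lemma limit_var_vartheta_sq:
  "vartheta_sq CARD('d) p r / ((1 - r) * Gamma (2 * (p - q))) = limit_var"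
proof -
  have "(x * b) / (D * (x * y)) / (b * G) = 1 / (D * y * G)" if "x \<noteq> 0" "b \<noteq> 0" for x b D y G :: real
    using that by simp
  moreover have "2 * real CARD('d) - 1 \<noteq> 0" "1 - r \<noteq> 0" using card_ge_1 r_range by (simp_all, linarith)
  ultimately show ?thesis
    unfolding vartheta_sq_def superdiffusive_gap limit_var_def by blast
qed

lemma limit_var_pos:
  assumes super: "2 * (p - q) > 1 - r"
  shows "limit_var > 0"
  unfolding limit_var_def
  using super r_range card_ge_1 by (intro divide_pos_pos mult_pos_pos Gamma_real_pos) auto

text \<open>By the conditional mean, one step multiplies the walk by $1 + (p-q)/n$ on average, which is the
  quotient of consecutive normalisations.\<close>

lemma normalised_walk_martingale:
  assumes pq: "p - q \<ge> 0"
  shows "L2_martingale M (\<lambda>n. past (Suc n)) (\<lambda>n \<omega>. walk X (Suc n) \<omega> $ a / growth (p - q) (Suc n))"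
proof unfold_locales
  fix n
  show "subalgebra M (past (Suc n))" by (rule subalgebra_past)
  show "sets (past (Suc n)) \<subseteq> sets (past (Suc (Suc n)))" by (rule past_mono) simp
  note [measurable] = walk_past[of "Suc n"]
  show "(\<lambda>\<omega>. walk X (Suc n) \<omega> $ a / growth (p - q) (Suc n)) \<in> borel_measurable (past (Suc n))" by measurable
  show "sq_integrable M (\<lambda>\<omega>. walk X (Suc n) \<omega> $ a / growth (p - q) (Suc n))"
    using sq_integrable_cmult[OF sq_integrable_walk, of "1 / growth (p - q) (Suc n)" "Suc n" a] by simp
  fix Z assume Z: "Z \<in> borel_measurable (past (Suc n))" "sq_integrable M Z"
  define m where "m = Suc n"
  have m: "m \<ge> 1" by (simp add: m_def)
  let ?g = "growth (p - q)"
  have "(\<integral>\<omega>. Z \<omega> * (walk X (Suc m) \<omega> $ a / ?g (Suc m) - walk X m \<omega> $ a / ?g m) \<partial>M) =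
      (\<integral>\<omega>. 1 / ?g (Suc m) * (Z \<omega> * X (m + 1) \<omega> $ a) + (1 / ?g (Suc m) - 1 / ?g m) * (Z \<omega> * walk X m \<omega> $ a) \<partial>M)"
    by (intro Bochner_Integration.integral_cong)
      (auto simp: walk_Suc algebra_simps add_divide_distrib simp del: growth.simps)
  also have "\<dots> = 1 / ?g (Suc m) * (\<integral>\<omega>. Z \<omega> * X (m + 1) \<omega> $ a \<partial>M)
      + (1 / ?g (Suc m) - 1 / ?g m) * (\<integral>\<omega>. Z \<omega> * walk X m \<omega> $ a \<partial>M)"
    using sq_integrable_mult[OF Z(2) sq_integrable_X, of "m + 1" a] sq_integrable_mult[OF Z(2) sq_integrable_walk, of m a]
    by (simp del: growth.simps)
  also have "\<dots> = (1 / ?g (Suc m) * (1 + (p - q) / real m) - 1 / ?g m) * (\<integral>\<omega>. Z \<omega> * walk X m \<omega> $ a \<partial>M)"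
  proof -
    have "u * (x * E) + (u - v) * E = (u * (1 + x) - v) * E" for u v x E :: real
      by (simp add: algebra_simps)
    then show ?thesis
      unfolding conditional_mean[OF m Z(1)[folded m_def] sq_integrable_integrable[OF Z(2)]] .
  qed
  also have "1 / ?g (Suc m) * (1 + (p - q) / real m) - 1 / ?g m = 0"
  proof -
    have "1 + (p - q) / real m > 0" using pq by (intro add_pos_nonneg) auto
    then show ?thesis using growth_pos[OF pq, of m] by simp
  qed
  finally show "(\<integral>\<omega>. Z \<omega> * (walk X (Suc (Suc n)) \<omega> $ a / ?g (Suc (Suc n)) - walk X (Suc n) \<omega> $ a / ?g (Suc n)) \<partial>M) = 0"
    by (simp add: m_def)
qed

text \<open>The second moments of the martingale converge because both $E[S_n^2]$ and the squared
  normalisation are of order $n^{2(p-q)}$.  Its limit is then rescaled by $\Gamma(1 + p - q)$, the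
  limiting ratio of the two normalisations.\<close>

lemma coordinate_convergence:
  assumes super: "2 * (p - q) > 1 - r"
  obtains l where "AE \<omega> in M. (\<lambda>n. walk X n \<omega> $ a / real n powr (p - q)) \<longlonglongrightarrow> l \<omega>"
    "L2_tendsto M (\<lambda>n \<omega>. walk X n \<omega> $ a / real n powr (p - q)) l"
proof -
  let ?g = "growth (p - q)" and ?P = "\<lambda>n. real n powr (p - q)"
  have pq: "p - q > 0" using super r_range by auto
  interpret L2_martingale M "\<lambda>n. past (Suc n)" "\<lambda>n \<omega>. walk X (Suc n) \<omega> $ a / ?g (Suc n)"
    by (rule normalised_walk_martingale) (use pq in simp)
  have rate: "(\<lambda>n. ?g n / ?P n) \<longlonglongrightarrow> 1 / Gamma (1 + (p - q))" by (rule growth_asymptotics[OF pq])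
  have Gpos: "Gamma (1 + (p - q)) > 0" using pq by (intro Gamma_real_pos) auto
  have "(\<lambda>n. walk_var n / real n powr (2 * (p - q)) / (?g n / ?P n)\<^sup>2) \<longlonglongrightarrow> limit_var / (1 / Gamma (1 + (p - q)))\<^sup>2"
    unfolding limit_var_def
    by (intro tendsto_divide tendsto_power walk_var_asymptotics rate super) (use Gpos in auto)
  from LIMSEQ_Suc[OF this]
  have "(\<lambda>n. \<integral>\<omega>. (walk X (Suc n) \<omega> $ a / ?g (Suc n))\<^sup>2 \<partial>M) \<longlonglongrightarrow> limit_var / (1 / Gamma (1 + (p - q)))\<^sup>2"
  proof (rule Lim_transform_eventually, intro always_eventually allI)
    fix n
    have "(\<integral>\<omega>. (walk X (Suc n) \<omega> $ a / ?g (Suc n))\<^sup>2 \<partial>M) =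
        (\<integral>\<omega>. walk X (Suc n) \<omega> $ a * walk X (Suc n) \<omega> $ a \<partial>M) / (?g (Suc n))\<^sup>2"
      by (simp add: power_divide power2_eq_square del: growth.simps)
    also have "\<dots> = walk_var (Suc n) / (?g (Suc n))\<^sup>2"
      by (simp add: walk_covariance[OF super] del: growth.simps)
    also have "\<dots> = walk_var (Suc n) / real (Suc n) powr (2 * (p - q)) / (?g (Suc n) / ?P (Suc n))\<^sup>2"
    proof -
      have "real (Suc n) powr (2 * (p - q)) = (?P (Suc n))\<^sup>2"
        by (simp add: power2_eq_square powr_add[symmetric])
      moreover have "?P (Suc n) \<noteq> 0" by simp
      ultimately show ?thesis by (simp add: power_divide del: growth.simps of_nat_Suc)
    qed
    finally show "walk_var (Suc n) / real (Suc n) powr (2 * (p - q)) / (?g (Suc n) / ?P (Suc n))\<^sup>2 =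
        (\<integral>\<omega>. (walk X (Suc n) \<omega> $ a / ?g (Suc n))\<^sup>2 \<partial>M)" ..
  qed
  from convergence[OF this] obtain z where z: "AE \<omega> in M. (\<lambda>n. walk X (Suc n) \<omega> $ a / ?g (Suc n)) \<longlonglongrightarrow> z \<omega>"
    "L2_tendsto M (\<lambda>n \<omega>. walk X (Suc n) \<omega> $ a / ?g (Suc n)) z" .
  have rescale: "?g (Suc n) / ?P (Suc n) * (x / ?g (Suc n)) = x / ?P (Suc n)" for n x
    using growth_pos[of "p - q" "Suc n"] pq by (simp del: growth.simps)
  show thesis
  proof (rule that)
    show "AE \<omega> in M. (\<lambda>n. walk X n \<omega> $ a / ?P n) \<longlonglongrightarrow> 1 / Gamma (1 + (p - q)) * z \<omega>"
      using z(1)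
    proof eventually_elim
      case (elim \<omega>)
      from tendsto_mult[OF LIMSEQ_Suc[OF rate] elim] show ?case
        unfolding rescale by (rule LIMSEQ_imp_Suc)
    qed
    from L2_tendsto_scale[OF z(2) LIMSEQ_Suc[OF rate]]
    have "L2_tendsto M (\<lambda>n \<omega>. walk X (Suc n) \<omega> $ a / ?P (Suc n)) (\<lambda>\<omega>. 1 / Gamma (1 + (p - q)) * z \<omega>)"
      unfolding rescale .
    then show "L2_tendsto M (\<lambda>n \<omega>. walk X n \<omega> $ a / ?P n) (\<lambda>\<omega>. 1 / Gamma (1 + (p - q)) * z \<omega>)"
      by (rule L2_tendsto_imp_Suc[where f = "\<lambda>n \<omega>. walk X n \<omega> $ a / ?P n"])
        (simp add: walk_def sq_integrable_const)
  qed
qed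

lemma limit_moments:
  assumes super: "2 * (p - q) > 1 - r"
    and l: "\<And>a. L2_tendsto M (\<lambda>n \<omega>. walk X n \<omega> $ a / real n powr (p - q)) (l a)"
  shows "expectation (l a) = 0"
    and "expectation (\<lambda>\<omega>. l a \<omega> * l c \<omega>) = limit_var * of_bool (a = c)"
proof -
  have "L2_tendsto M (\<lambda>_ _. 1) (\<lambda>_. 1)" by (simp add: L2_tendsto_def sq_integrable_const)
  from L2_tendsto_product_integral[OF l this]
  have "(\<lambda>n. expectation (\<lambda>\<omega>. walk X n \<omega> $ a / real n powr (p - q))) \<longlonglongrightarrow> expectation (l a)" by simp
  moreover have zero: "expectation (\<lambda>\<omega>. walk X n \<omega> $ a / real n powr (p - q)) = 0" for n
    using walk_mean[of n a] by (cases "n = 0") (auto simp: walk_def)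
  ultimately show "expectation (l a) = 0" unfolding zero by (simp only: LIMSEQ_const_iff)
  have "(\<lambda>n. walk_var n / real n powr (2 * (p - q)) * of_bool (a = c)) \<longlonglongrightarrow> limit_var * of_bool (a = c)"
    unfolding limit_var_def by (intro tendsto_mult tendsto_const walk_var_asymptotics super)
  moreover have "walk_var n / real n powr (2 * (p - q)) * of_bool (a = c) =
      expectation (\<lambda>\<omega>. walk X n \<omega> $ a / real n powr (p - q) * (walk X n \<omega> $ c / real n powr (p - q)))" if "n \<ge> 1" for n
  proof -
    have "real n powr (2 * (p - q)) = real n powr (p - q) * real n powr (p - q)"
      by (simp add: powr_add[symmetric])
    then show ?thesis using walk_covariance[OF super that, of a c] by simp
  qed
  ultimately have "(\<lambda>n. expectation (\<lambda>\<omega>. walk X n \<omega> $ a / real n powr (p - q) * (walk X n \<omega> $ c / real n powr (p - q))))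
      \<longlonglongrightarrow> limit_var * of_bool (a = c)"
    by (rule Lim_transform_eventually[OF _ eventually_mono[OF eventually_ge_at_top[of 1]]])
  with L2_tendsto_product_integral[OF l l]
  show "expectation (\<lambda>\<omega>. l a \<omega> * l c \<omega>) = limit_var * of_bool (a = c)" by (rule LIMSEQ_unique)
qed

end

lemma matrix_expansion:
  fixes B :: "real^'n::finite^'m::finite"
  shows "B = (\<Sum>a\<in>UNIV. \<Sum>c\<in>UNIV. (B $ a $ c) *\<^sub>R axis a (axis c 1))"
proof -
  have "(\<Sum>a\<in>UNIV. \<Sum>c\<in>UNIV. (B $ a $ c) *\<^sub>R axis a (axis c 1)) $ i $ j = B $ i $ j" for i j
  proof -
    have "(\<Sum>a\<in>UNIV. \<Sum>c\<in>UNIV. (B $ a $ c) *\<^sub>R axis a (axis c 1)) $ i $ j =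
        (\<Sum>a\<in>UNIV. \<Sum>c\<in>UNIV. if c = j then (if a = i then B $ a $ c else 0) else 0)"
      unfolding sum_component by (intro sum.cong refl) (auto simp: axis_def)
    then show ?thesis by simp
  qed
  then show ?thesis by (simp add: vec_eq_iff)
qed

theorem theorem3p7:
  fixes M :: "'a measure"
    and p q r :: real
    and idx :: "nat \<Rightarrow> 'd::finite"
    and X :: "nat \<Rightarrow> 'a \<Rightarrow> real^'d"
    and A :: "nat \<Rightarrow> 'a \<Rightarrow> real^'d^'d"
    and U :: "nat \<Rightarrow> 'a \<Rightarrow> nat"
  assumes "merws M p q r idx X A U"
    and "p > p_crit CARD('d) r"
  shows "\<exists>L :: 'a \<Rightarrow> real^'d.
      L \<in> borel_measurable M \<and> nondegenerate M L \<and>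
      (AE \<omega> in M. (\<lambda>n. walk X n \<omega> /\<^sub>R (real n powr (p - q))) \<longlonglongrightarrow> L \<omega>) \<and>
      (\<forall>n\<ge>1. integrable M (\<lambda>\<omega>. (norm (walk X n \<omega> /\<^sub>R (real n powr (p - q)) - L \<omega>))\<^sup>2)) \<and>
      (\<lambda>n. \<integral>\<omega>. (norm (walk X n \<omega> /\<^sub>R (real n powr (p - q)) - L \<omega>))\<^sup>2 \<partial>M) \<longlonglongrightarrow> 0 \<and>
      integrable M L \<and> (\<integral>\<omega>. L \<omega> \<partial>M) = 0 \<and>
      integrable M (\<lambda>\<omega>. outer (L \<omega>) (L \<omega>)) \<and>
      (\<integral>\<omega>. outer (L \<omega>) (L \<omega>) \<partial>M) =
        (vartheta_sq CARD('d) p r / ((1 - r) * Gamma (2 * (p - q)))) *\<^sub>R mat 1"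
proof -
  interpret merws M p q r idx X A U by fact
  have super: "2 * (p - q) > 1 - r" by (rule superdiffusive) fact
  let ?W = "\<lambda>n \<omega>. walk X n \<omega> /\<^sub>R (real n powr (p - q))"
  have W_nth: "?W n \<omega> $ a = walk X n \<omega> $ a / real n powr (p - q)" for n \<omega> a
    by (simp add: divide_inverse mult.commute)
  have "\<exists>l. \<forall>a. (AE \<omega> in M. (\<lambda>n. walk X n \<omega> $ a / real n powr (p - q)) \<longlonglongrightarrow> l a \<omega>) \<and>
      L2_tendsto M (\<lambda>n \<omega>. walk X n \<omega> $ a / real n powr (p - q)) (l a)"
  proof (intro choice allI)
    fix a
    obtain l where "AE \<omega> in M. (\<lambda>n. walk X n \<omega> $ a / real n powr (p - q)) \<longlonglongrightarrow> l \<omega>"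
      "L2_tendsto M (\<lambda>n \<omega>. walk X n \<omega> $ a / real n powr (p - q)) l"
      by (rule coordinate_convergence[OF super])
    then show "\<exists>l. (AE \<omega> in M. (\<lambda>n. walk X n \<omega> $ a / real n powr (p - q)) \<longlonglongrightarrow> l \<omega>) \<and>
      L2_tendsto M (\<lambda>n \<omega>. walk X n \<omega> $ a / real n powr (p - q)) l" by blast
  qed
  then obtain l where l_lim: "\<And>a. AE \<omega> in M. (\<lambda>n. walk X n \<omega> $ a / real n powr (p - q)) \<longlonglongrightarrow> l a \<omega>"
    and l_L2: "\<And>a. L2_tendsto M (\<lambda>n \<omega>. walk X n \<omega> $ a / real n powr (p - q)) (l a)"
    by blast
  have l_sq: "sq_integrable M (l a)" for a using l_L2 by (simp add: L2_tendsto_def)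
  note l_int = sq_integrable_integrable[OF l_sq] and ll_int = sq_integrable_mult[OF l_sq l_sq]
  define L :: "'a \<Rightarrow> real^'d" where "L \<omega> = (\<Sum>a\<in>UNIV. l a \<omega> *\<^sub>R axis a 1)" for \<omega>
  have L_nth: "L \<omega> $ a = l a \<omega>" for \<omega> a
  proof -
    have "L \<omega> $ a = (\<Sum>b\<in>UNIV. if b = a then l b \<omega> else 0)"
      unfolding L_def sum_component by (intro sum.cong) (auto simp: axis_def)
    then show ?thesis by simp
  qed
  have norm_sq: "(norm (?W n \<omega> - L \<omega>))\<^sup>2 = (\<Sum>a\<in>UNIV. (walk X n \<omega> $ a / real n powr (p - q) - l a \<omega>)\<^sup>2)" for n \<omega>
    unfolding power2_norm_eq_inner inner_vec_def vector_minus_component W_nth L_nth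
    by (simp add: power2_eq_square)
  have diff_int: "integrable M (\<lambda>\<omega>. (walk X n \<omega> $ a / real n powr (p - q) - l a \<omega>)\<^sup>2)" for n a
    using l_L2[of a] by (intro sq_integrable_square sq_integrable_diff) (auto simp: L2_tendsto_def)
  show ?thesis
  proof (intro exI[of _ L] conjI allI impI)
    show "integrable M L" unfolding L_def by (intro Bochner_Integration.integrable_sum integrable_scaleR_left l_int)
    then show "L \<in> borel_measurable M" by (rule borel_measurable_integrable)
    have "AE \<omega> in M. \<forall>a. (\<lambda>n. walk X n \<omega> $ a / real n powr (p - q)) \<longlonglongrightarrow> l a \<omega>"
      using l_lim by (simp add: AE_all_countable)
    then show "AE \<omega> in M. (\<lambda>n. ?W n \<omega>) \<longlonglongrightarrow> L \<omega>"
      by eventually_elim (rule vec_tendstoI, simp only: W_nth L_nth)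
    show "integrable M (\<lambda>\<omega>. (norm (?W n \<omega> - L \<omega>))\<^sup>2)" for n
      unfolding norm_sq by (intro Bochner_Integration.integrable_sum diff_int)
    have "(\<lambda>n. \<Sum>a\<in>UNIV. \<integral>\<omega>. (walk X n \<omega> $ a / real n powr (p - q) - l a \<omega>)\<^sup>2 \<partial>M) \<longlonglongrightarrow> (\<Sum>a\<in>(UNIV :: 'd set). 0)"
      using l_L2 by (intro tendsto_sum) (simp add: L2_tendsto_def)
    then show "(\<lambda>n. \<integral>\<omega>. (norm (?W n \<omega> - L \<omega>))\<^sup>2 \<partial>M) \<longlonglongrightarrow> 0"
      unfolding norm_sq using diff_int by simp
    show "(\<integral>\<omega>. L \<omega> \<partial>M) = 0"
      unfolding L_def using l_int limit_moments(1)[OF super l_L2] by simp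
    have outer_eq: "outer (L \<omega>) (L \<omega>) = (\<Sum>a\<in>UNIV. \<Sum>c\<in>UNIV. (l a \<omega> * l c \<omega>) *\<^sub>R axis a (axis c 1))" for \<omega>
      by (subst matrix_expansion) (simp add: outer_def L_nth)
    show "integrable M (\<lambda>\<omega>. outer (L \<omega>) (L \<omega>))"
      unfolding outer_eq by (intro Bochner_Integration.integrable_sum integrable_scaleR_left ll_int)
    have "(\<integral>\<omega>. outer (L \<omega>) (L \<omega>) \<partial>M) =
        (\<Sum>a\<in>UNIV. \<Sum>c\<in>UNIV. (limit_var * of_bool (a = c)) *\<^sub>R axis a (axis c 1))"
      unfolding outer_eq limit_moments(2)[OF super l_L2, symmetric]
      using ll_int by (simp add: Bochner_Integration.integral_sum Bochner_Integration.integrable_sum)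
    also have "\<dots> = limit_var *\<^sub>R mat 1"
      by (subst (2) matrix_expansion) (simp add: mat_def of_bool_def)
    finally show "(\<integral>\<omega>. outer (L \<omega>) (L \<omega>) \<partial>M) =
        (vartheta_sq CARD('d) p r / ((1 - r) * Gamma (2 * (p - q)))) *\<^sub>R mat 1"
      unfolding limit_var_vartheta_sq .
    show "nondegenerate M L"
      unfolding nondegenerate_def
    proof (intro allI impI notI)
      fix u :: "real^'d" and c assume u: "u \<noteq> 0" and const: "AE \<omega> in M. u \<bullet> L \<omega> = c"
      \<comment> \<open>A constant value of $u \bullet L$ would be its mean, zero; but its second moment is
  $\|u\|^2$ times the positive limiting variance.\<close>
      have uL: "u \<bullet> L \<omega> = (\<Sum>a\<in>UNIV. u $ a * l a \<omega>)" for \<omega>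
        by (simp add: inner_vec_def L_nth)
      have [measurable]: "(\<lambda>\<omega>. u \<bullet> L \<omega>) \<in> borel_measurable M"
        using \<open>L \<in> borel_measurable M\<close> by measurable
      have "c = (\<integral>\<omega>. u \<bullet> L \<omega> \<partial>M)"
        using integral_cong_AE[OF _ _ const] by (simp add: prob_space)
      also have "\<dots> = 0" unfolding uL using l_int limit_moments(1)[OF super l_L2] by simp
      finally have "c = 0" .
      have "0 = (\<integral>\<omega>. (u \<bullet> L \<omega>)\<^sup>2 \<partial>M)"
      proof -
        have "(\<integral>\<omega>. (u \<bullet> L \<omega>)\<^sup>2 \<partial>M) = (\<integral>\<omega>. 0 \<partial>M)"
          by (rule integral_cong_AE) (use const \<open>c = 0\<close> in auto)
        then show ?thesis by simp
      qed
      also have "\<dots> = (\<integral>\<omega>. (\<Sum>a\<in>UNIV. \<Sum>b\<in>UNIV. u $ a * u $ b * (l a \<omega> * l b \<omega>)) \<partial>M)"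
        unfolding uL power2_eq_square sum_product by (simp add: mult_ac)
      also have "\<dots> = (\<Sum>a\<in>UNIV. \<Sum>b\<in>UNIV. u $ a * u $ b * (limit_var * of_bool (a = b)))"
        unfolding limit_moments(2)[OF super l_L2, symmetric]
        using ll_int by (simp add: Bochner_Integration.integral_sum Bochner_Integration.integrable_sum)
      also have "\<dots> = (\<Sum>a\<in>UNIV. \<Sum>b\<in>UNIV. if b = a then u $ a * u $ a * limit_var else 0)"
        by (intro sum.cong) auto
      also have "\<dots> = (u \<bullet> u) * limit_var"
        by (simp add: inner_vec_def sum_distrib_right)
      also have "\<dots> > 0" using u limit_var_pos[OF super] by simp
      finally show False by simp
    qed
  qed
qed

end
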